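(* Let $\Omega$ be finite, let $\mathcal L$ satisfy (Irr) and (Rev), and let $\{\mathbf c^{\mathrm{cpl}}(\eta,\sigma\eta,\cdot,\cdot)\}_{(\eta,\sigma)\in\mathcal S}$ be coupling rates. Suppose that: - there exists $\kappa'\ge0$ such that $$\frac12\sum_{(\eta,\sigma)\in\mathcal S}\ \sum_{\gamma,\bar\gamma\in G^*}c(\eta,\sigma)\,\mathbf c^{\mathrm{cpl}}(\eta,\sigma\eta,\gamma,\bar\gamma)\,\boldsymbol\nabla_{\gamma,\bar\gamma}f^\phi(\eta,\sigma\eta)\,\mathbf m(\eta)\le-\kappa'\,\mathcal E(\phi'(f),f)$$ for every admissible $\phi$ and every $f:\Omega\to(0,\infty)$; - there exist $\kappa'',\kappa'''\ge0$ such that $$\inf_{(\eta,\sigma)\in\mathcal S}\min\{\mathbf c^{\mathrm{cpl}}(\eta,\sigma\eta,\sigma,\mathrm e),\ \mathbf c^{\mathrm{cpl}}(\eta,\sigma\eta,\mathrm e,\sigma^{-1})\}\ge\kappa''$$ and $$\inf_{(\eta,\sigma)\in\mathcal S}\ \sum_{\substack{\gamma,\bar\gamma\in G^*\\ \gamma\eta=\bar\gamma\sigma\eta}}\mathbf c^{\mathrm{cpl}}(\eta,\sigma\eta,\gamma,\bar\gamma)\ge\kappa'''.$$ Then: (i) for every admissible $\phi$ the convex Sobolev inequality $\kappa_\phi\mathcal H^\phi(f|\mathbf m)\le\mathcal E(\phi'(f),f)$ for all $f>0$ holds with $\kappa_\phi=\kappa'$; (ii) the modified logarithmic Sobolev inequality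 $\kappa_1\mathcal H^{\phi_1}(f|\mathbf m)\le\mathcal E(\log f,f)$ for all $f>0$ holds with $\kappa_1=\kappa'+2\kappa''$; (iii) for every $\alpha\in(1,2]$ the Beckner inequality $\kappa_\alpha\mathcal H^{\phi_\alpha}(f|\mathbf m)\le\frac{\alpha}{\alpha-1}\mathcal E(f^{\alpha-1},f)$ for all $f>0$ holds with $\kappa_\alpha=\kappa'+(\alpha-1)\kappa'''$.
   Context: Setting: $\Omega$ is a state space, $G$ a collection of maps $\sigma:\Omega\to\Omega$ (moves), $c:\Omega\times G\to[0,\infty)$ the transition rates, $\nabla_\sigma f(\eta)=f(\sigma\eta)-f(\eta)$ and $\mathcal Lf(\eta)=\sum_{\sigma\in G}c(\eta,\sigma)\nabla_\sigma f(\eta)$. (Irr): $G$ is finite, $\mathcal L$ is irreducible and admits an invariant probability measure $\mathbf m$ with $\sum_{\eta,\sigma}c(\eta,\sigma)\mathbf m(\eta)<\infty$. (Rev): there is an involution $\sigma\mapsto\sigma^{-1}$ of $G$ such that $\sigma^{-1}(\sigma(\eta))=\eta$ whenever $\mathbf m(\eta)c(\eta,\sigma)>0$, and $\sum_{\eta,\sigma}F(\eta,\sigma)c(\eta,\sigma)\mathbf m(\eta)=\sum_{\eta,\sigma}F(\sigma\eta,\sigma^{-1})c(\eta,\sigma)\mathbf m(\eta)$ for all bounded $F:\Omega\times G\to\mathbb R$. $\mathcal S=\{(\eta,\sigma)\in\Omega\times G:c(\eta,\sigma)>0\}$. $G^*=G\cup\{\mathrm e\}$ where $\mathrm e$ is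 an additional null move with $\mathrm e\eta=\eta$ for all $\eta$. Coupling rates for a pair $(\eta,\bar\eta)$ are a function $\mathbf c^{\mathrm{cpl}}(\eta,\bar\eta,\cdot,\cdot):G^*\times G^*\to[0,\infty)$ with $\sum_{\bar\gamma\in G^*}\mathbf c^{\mathrm{cpl}}(\eta,\bar\eta,\gamma,\bar\gamma)=c(\eta,\gamma)$ for all $\gamma\in G$ and $\sum_{\gamma\in G^*}\mathbf c^{\mathrm{cpl}}(\eta,\bar\eta,\gamma,\bar\gamma)=c(\bar\eta,\bar\gamma)$ for all $\bar\gamma\in G$. For $F:\Omega\times\Omega\to\mathbb R$, $\boldsymbol\nabla_{\gamma,\bar\gamma}F(\eta,\bar\eta)=F(\gamma\eta,\bar\gamma\bar\eta)-F(\eta,\bar\eta)$. $\phi:[0,\infty)\to[0,\infty)$ is admissible if it is convex, twice differentiable on $(0,\infty)$, and $\Phi(a,b):=(\phi'(b)-\phi'(a))(b-a)$ is convex on $(0,\infty)^2$. For $f:\Omega\to(0,\infty)$, $f^\phi(\eta,\bar\eta)=\Phi(f(\eta),f(\bar\eta))$. $\mathcal E(f,g)=-\sum_\eta g(\eta)(\mathcal Lf)(\eta)\mathbf m(\eta)$ and $\mathcal H^\phi(f|\mathbf m)=\sum_\eta\phi(f(\eta))\mathbf m(\eta)-\phi\big(\sum_\eta f(\eta)\mathbf m(\eta)\big)$. Finally $\phi_1(a)=a\log a-a+1$ and $\phi_\alpha(a)=\frac1{\alpha-1}(a^\alpha-a)-a+1$ for $\alpha\in(1,2]$. *)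

theory Defs
  imports "HOL-Probability.Probability"
begin

text \<open>The finite state space is a type of class \<open>finite\<close>. The set \<open>G\<close> consists of maps on this type;
  rates, involutions and couplings are total functions, used only at moves from \<open>G\<close>.\<close>

type_synonym 'a move = "'a \<Rightarrow> 'a"

definition grad :: "'a move \<Rightarrow> ('a \<Rightarrow> real) \<Rightarrow> 'a \<Rightarrow> real" where
  "grad \<sigma> f \<eta> = f (\<sigma> \<eta>) - f \<eta>"

definition generator :: "'a move set \<Rightarrow> ('a \<Rightarrow> 'a move \<Rightarrow> real) \<Rightarrow> ('a \<Rightarrow> real) \<Rightarrow> 'a \<Rightarrow> real" where
  "generator G c f \<eta> = (\<Sum>\<sigma>\<in>G. c \<eta> \<sigma> * grad \<sigma> f \<eta>)"

definition transition_rates :: "'a move set \<Rightarrow> ('a \<Rightarrow> 'a move \<Rightarrow> real) \<Rightarrow> bool" where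
  "transition_rates G c \<longleftrightarrow> (\<forall>\<eta>. \<forall>\<sigma>\<in>G. 0 \<le> c \<eta> \<sigma>)"

definition active_pairs :: "'a move set \<Rightarrow> ('a \<Rightarrow> 'a move \<Rightarrow> real) \<Rightarrow> ('a \<times> 'a move) set" where
  "active_pairs G c = {(\<eta>, \<sigma>). \<sigma> \<in> G \<and> c \<eta> \<sigma> > 0}"

definition irreducible_rates :: "'a move set \<Rightarrow> ('a \<Rightarrow> 'a move \<Rightarrow> real) \<Rightarrow> bool" where
  "irreducible_rates G c \<longleftrightarrow>
     (\<forall>\<eta> \<eta>'. (\<eta>, \<eta>') \<in> ((\<lambda>(\<xi>, \<sigma>). (\<xi>, \<sigma> \<xi>)) ` active_pairs G c)\<^sup>*)"

definition invariant_measure ::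
  "'a::finite move set \<Rightarrow> ('a \<Rightarrow> 'a move \<Rightarrow> real) \<Rightarrow> 'a pmf \<Rightarrow> bool" where
  "invariant_measure G c m \<longleftrightarrow> (\<forall>f. (\<Sum>\<eta>\<in>UNIV. generator G c f \<eta> * pmf m \<eta>) = 0)"

text \<open>The finiteness of \<open>G\<close>, the summability below and the boundedness in \<open>Rev\<close> are automatic on a
  finite state space; they are kept so that the conditions read as in the general case.\<close>

definition Irr :: "'a::finite move set \<Rightarrow> ('a \<Rightarrow> 'a move \<Rightarrow> real) \<Rightarrow> 'a pmf \<Rightarrow> bool" where
  "Irr G c m \<longleftrightarrow> finite G \<and> irreducible_rates G c \<and> invariant_measure G c m \<and>
     (\<lambda>(\<eta>, \<sigma>). c \<eta> \<sigma> * pmf m \<eta>) summable_on (UNIV \<times> G)"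

definition Rev ::
  "'a::finite move set \<Rightarrow> ('a \<Rightarrow> 'a move \<Rightarrow> real) \<Rightarrow> 'a pmf \<Rightarrow> ('a move \<Rightarrow> 'a move) \<Rightarrow> bool" where
  "Rev G c m \<iota> \<longleftrightarrow>
     (\<forall>\<sigma>\<in>G. \<iota> \<sigma> \<in> G \<and> \<iota> (\<iota> \<sigma>) = \<sigma>) \<and>
     (\<forall>\<eta>. \<forall>\<sigma>\<in>G. pmf m \<eta> * c \<eta> \<sigma> > 0 \<longrightarrow> \<iota> \<sigma> (\<sigma> \<eta>) = \<eta>) \<and>
     (\<forall>F :: 'a \<Rightarrow> 'a move \<Rightarrow> real. bounded ((\<lambda>(\<eta>, \<sigma>). F \<eta> \<sigma>) ` (UNIV \<times> G)) \<longrightarrow>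
        (\<Sum>\<eta>\<in>UNIV. \<Sum>\<sigma>\<in>G. F \<eta> \<sigma> * c \<eta> \<sigma> * pmf m \<eta>) =
        (\<Sum>\<eta>\<in>UNIV. \<Sum>\<sigma>\<in>G. F (\<sigma> \<eta>) (\<iota> \<sigma>) * c \<eta> \<sigma> * pmf m \<eta>))"

text \<open>\<open>None\<close> is the additional null move; it differs from the identity map even if the latter
  belongs to \<open>G\<close>.\<close>

definition Gstar :: "'a move set \<Rightarrow> 'a move option set" where
  "Gstar G = insert None (Some ` G)"

definition act :: "'a move option \<Rightarrow> 'a \<Rightarrow> 'a" where
  "act \<gamma> \<eta> = (case \<gamma> of None \<Rightarrow> \<eta> | Some \<sigma> \<Rightarrow> \<sigma> \<eta>)"

definition coupling_rates ::
  "'a move set \<Rightarrow> ('a \<Rightarrow> 'a move \<Rightarrow> real) \<Rightarrow> 'a \<Rightarrow> 'a \<Rightarrow>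
     ('a move option \<Rightarrow> 'a move option \<Rightarrow> real) \<Rightarrow> bool" where
  "coupling_rates G c \<eta> \<eta>' q \<longleftrightarrow>
     (\<forall>\<gamma>\<in>Gstar G. \<forall>\<gamma>'\<in>Gstar G. 0 \<le> q \<gamma> \<gamma>') \<and>
     (\<forall>\<gamma>\<in>G. (\<Sum>\<gamma>'\<in>Gstar G. q (Some \<gamma>) \<gamma>') = c \<eta> \<gamma>) \<and>
     (\<forall>\<gamma>'\<in>G. (\<Sum>\<gamma>\<in>Gstar G. q \<gamma> (Some \<gamma>')) = c \<eta>' \<gamma>')"

definition grad2 ::
  "'a move option \<Rightarrow> 'a move option \<Rightarrow> ('a \<Rightarrow> 'a \<Rightarrow> real) \<Rightarrow> 'a \<Rightarrow> 'a \<Rightarrow> real" where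
  "grad2 \<gamma> \<gamma>' F \<eta> \<eta>' = F (act \<gamma> \<eta>) (act \<gamma>' \<eta>') - F \<eta> \<eta>'"

definition Phi :: "(real \<Rightarrow> real) \<Rightarrow> real \<Rightarrow> real \<Rightarrow> real" where
  "Phi \<phi> a b = (deriv \<phi> b - deriv \<phi> a) * (b - a)"

text \<open>A function on \<open>[0, \<infinity>)\<close> is a total function whose values at negative arguments are irrelevant.
  In particular \<open>deriv\<close> is only meaningful, and only used, on \<open>(0, \<infinity>)\<close>.\<close>

definition admissible :: "(real \<Rightarrow> real) \<Rightarrow> bool" where
  "admissible \<phi> \<longleftrightarrow>
     (\<forall>x\<ge>0. 0 \<le> \<phi> x) \<and>
     convex_on {0..} \<phi> \<and>
     (\<forall>x>0. \<phi> differentiable (at x) \<and> deriv \<phi> differentiable (at x)) \<and>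
     convex_on ({0<..} \<times> {0<..}) (\<lambda>(a, b). Phi \<phi> a b)"

definition f_phi :: "(real \<Rightarrow> real) \<Rightarrow> ('a \<Rightarrow> real) \<Rightarrow> 'a \<Rightarrow> 'a \<Rightarrow> real" where
  "f_phi \<phi> f \<eta> \<eta>' = Phi \<phi> (f \<eta>) (f \<eta>')"

definition dirichlet ::
  "'a::finite move set \<Rightarrow> ('a \<Rightarrow> 'a move \<Rightarrow> real) \<Rightarrow> 'a pmf \<Rightarrow> ('a \<Rightarrow> real) \<Rightarrow> ('a \<Rightarrow> real) \<Rightarrow> real"
  where
  "dirichlet G c m f g = - (\<Sum>\<eta>\<in>UNIV. g \<eta> * generator G c f \<eta> * pmf m \<eta>)"

definition phi_entropy :: "'a::finite pmf \<Rightarrow> (real \<Rightarrow> real) \<Rightarrow> ('a \<Rightarrow> real) \<Rightarrow> real" where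
  "phi_entropy m \<phi> f =
     (\<Sum>\<eta>\<in>UNIV. \<phi> (f \<eta>) * pmf m \<eta>) - \<phi> (\<Sum>\<eta>\<in>UNIV. f \<eta> * pmf m \<eta>)"

text \<open>At \<open>a = 0\<close> the conventions \<open>ln 0 = 0\<close> and \<open>0 powr \<alpha> = 0\<close> give the continuous extensions.\<close>

definition phi_one :: "real \<Rightarrow> real" where
  "phi_one a = a * ln a - a + 1"

definition phi_alpha :: "real \<Rightarrow> real \<Rightarrow> real" where
  "phi_alpha \<alpha> a = 1 / (\<alpha> - 1) * (a powr \<alpha> - a) - a + 1"

definition convex_sobolev ::
  "'a::finite move set \<Rightarrow> ('a \<Rightarrow> 'a move \<Rightarrow> real) \<Rightarrow> 'a pmf \<Rightarrow> (real \<Rightarrow> real) \<Rightarrow> real \<Rightarrow> bool" where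
  "convex_sobolev G c m \<phi> \<kappa> \<longleftrightarrow>
     (\<forall>f. (\<forall>\<eta>. 0 < f \<eta>) \<longrightarrow>
        \<kappa> * phi_entropy m \<phi> f \<le> dirichlet G c m (\<lambda>\<eta>. deriv \<phi> (f \<eta>)) f)"

definition modified_log_sobolev ::
  "'a::finite move set \<Rightarrow> ('a \<Rightarrow> 'a move \<Rightarrow> real) \<Rightarrow> 'a pmf \<Rightarrow> real \<Rightarrow> bool" where
  "modified_log_sobolev G c m \<kappa> \<longleftrightarrow>
     (\<forall>f. (\<forall>\<eta>. 0 < f \<eta>) \<longrightarrow>
        \<kappa> * phi_entropy m phi_one f \<le> dirichlet G c m (\<lambda>\<eta>. ln (f \<eta>)) f)"

definition beckner ::
  "'a::finite move set \<Rightarrow> ('a \<Rightarrow> 'a move \<Rightarrow> real) \<Rightarrow> 'a pmf \<Rightarrow> real \<Rightarrow> real \<Rightarrow> bool" where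
  "beckner G c m \<alpha> \<kappa> \<longleftrightarrow>
     (\<forall>f. (\<forall>\<eta>. 0 < f \<eta>) \<longrightarrow>
        \<kappa> * phi_entropy m (phi_alpha \<alpha>) f
          \<le> \<alpha> / (\<alpha> - 1) * dirichlet G c m (\<lambda>\<eta>. f \<eta> powr (\<alpha> - 1)) f)"

end

theory Submission imports Defs begin

text \<open>The semigroup of the chain is replaced by its Euler scheme \<open>f \<mapsto> f + h * L f\<close> with a small step \<open>h\<close>.
  By the tangent inequality for \<open>\<phi>\<close>, one step decreases the entropy by at most \<open>h\<close> times the energy
  \<open>E(\<phi>' f, f)\<close>. By reversibility the energy is an average of \<open>Phi \<phi> (f \<eta>) (f (\<sigma> \<eta>))\<close>, and for small \<open>h\<close>
  the step moves \<open>(f \<eta>, f (\<sigma> \<eta>))\<close> to a convex combination of its values after the coupled moves, so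
  that Jensen's inequality and the contraction hypothesis bound the new energy by \<open>1 - h * \<kappa>'\<close> times
  the old one. Coupled moves that bring the two copies together improve this factor for \<open>phi_one\<close>
  and \<open>phi_alpha\<close>. Summing over the steps gives \<open>\<kappa>\<close> times the entropy below the energy, because the
  scheme converges to the mean by irreducibility; then \<open>h\<close> tends to \<open>0\<close>.\<close>

section \<open>The functions \<open>phi_one\<close> and \<open>phi_alpha\<close>\<close>

text \<open>Weighted AM-GM for \<open>t\<close> and \<open>1\<close> with weights \<open>q\<close>
  and \<open>1 - q\<close>.\<close>

lemma powr_le_affine:
  fixes t q :: real
  assumes "0 < t" "0 \<le> q" "q \<le> 1"
  shows "t powr q \<le> 1 - q + q * t"
  using Youngs_inequality_0[of q "1 - q" t 1] assms by simp

text \<open>Bernoulli's inequality, from \<open>powr_le_affine\<close> for the number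
  \<open>t powr p\<close> and the exponent \<open>1 / p\<close>.\<close>

lemma powr_ge_affine:
  fixes t p :: real
  assumes "0 \<le> t" "1 \<le> p"
  shows "1 + p * (t - 1) \<le> t powr p"
proof (cases "t = 0")
  case False
  with assms have t: "0 < t" by simp
  have "(t powr p) powr (1 / p) \<le> 1 - 1 / p + 1 / p * t powr p"
    using assms t by (intro powr_le_affine) auto
  moreover have "(t powr p) powr (1 / p) = t"
    using assms t by (simp add: powr_powr)
  ultimately have "p * t \<le> p * (1 - 1 / p + 1 / p * t powr p)"
    using assms by (intro mult_left_mono) auto
  also have "\<dots> = p - 1 + t powr p"
    using assms by (simp add: distrib_left right_diff_distrib)
  finally show ?thesis by (simp add: algebra_simps)
qed (use assms in simp)

text \<open>The supporting line at the intermediate point \<open>z\<close> is averaged over the two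
  end points. Since \<open>z > 0\<close> even when an end point is \<open>0\<close>, no slope at
  \<open>0\<close> is involved.\<close>

lemma convex_on_atLeast0_if_tangents:
  fixes \<phi> \<psi> :: "real \<Rightarrow> real"
  assumes tangent: "\<And>x z. 0 \<le> x \<Longrightarrow> 0 < z \<Longrightarrow> \<phi> z + \<psi> z * (x - z) \<le> \<phi> x"
  shows "convex_on {0..} \<phi>"
proof (rule convex_on_linorderI)
  fix t x y :: real
  assume t: "0 < t" "t < 1" and xy: "x \<in> {0..}" "y \<in> {0..}" "x < y"
  define z where "z = (1 - t) * x + t * y"
  have z: "0 < z"
    using t xy unfolding z_def by (intro add_nonneg_pos) auto
  have "(1 - t) * (\<phi> z + \<psi> z * (x - z)) + t * (\<phi> z + \<psi> z * (y - z)) \<le> (1 - t) * \<phi> x + t * \<phi> y"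
    using t xy z by (intro add_mono mult_left_mono tangent) auto
  moreover have "(1 - t) * (\<phi> z + \<psi> z * (x - z)) + t * (\<phi> z + \<psi> z * (y - z)) = \<phi> z + \<psi> z * ((1 - t) * x + t * y - z)"
    by algebra
  ultimately show "\<phi> ((1 - t) *\<^sub>R x + t *\<^sub>R y) \<le> (1 - t) * \<phi> x + t * \<phi> y"
    by (simp add: z_def[symmetric])
qed simp

text \<open>This is \<open>ln r \<le> r - 1\<close> at the ratio \<open>r = z / x\<close>; the end
  point \<open>x = 0\<close> is computed directly.\<close>

lemma phi_one_tangent:
  assumes "0 \<le> x" "0 < z"
  shows "phi_one z + ln z * (x - z) \<le> phi_one x"
proof (cases "x = 0")
  case False
  with assms have x: "0 < x" by simp
  have "x * ln (z / x) \<le> x * (z / x - 1)"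
    using x assms by (intro mult_left_mono ln_le_minus_one) auto
  then show ?thesis
    using x assms by (simp add: phi_one_def ln_div algebra_simps)
qed (use assms in \<open>simp add: phi_one_def algebra_simps\<close>)

text \<open>Closed form of the derivative of \<open>phi_alpha \<alpha>\<close> on the positive
  half-line; the constants make it vanish at \<open>1\<close>.\<close>

definition dphi_alpha :: "real \<Rightarrow> real \<Rightarrow> real" where
  "dphi_alpha \<alpha> a = \<alpha> / (\<alpha> - 1) * a powr (\<alpha> - 1) - 1 / (\<alpha> - 1) - 1"

text \<open>By homogeneity this is Bernoulli's inequality for the ratio \<open>x / z\<close>; the
  affine terms of \<open>phi_alpha\<close> cancel.\<close>

lemma phi_alpha_tangent:
  assumes "0 \<le> x" "0 < z" "1 < \<alpha>"
  shows "phi_alpha \<alpha> z + dphi_alpha \<alpha> z * (x - z) \<le> phi_alpha \<alpha> x"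
proof -
  have "z powr \<alpha> * (1 + \<alpha> * (x / z - 1)) \<le> z powr \<alpha> * (x / z) powr \<alpha>"
    using assms by (intro mult_left_mono powr_ge_affine) auto
  moreover have "z powr \<alpha> * (x / z) powr \<alpha> = x powr \<alpha>"
    using assms by (simp add: powr_divide)
  moreover have z: "z powr \<alpha> = z * z powr (\<alpha> - 1)"
    using assms by (simp add: powr_mult_base)
  moreover have "z powr \<alpha> * (1 + \<alpha> * (x / z - 1)) = z powr \<alpha> + \<alpha> * z powr (\<alpha> - 1) * (x - z)"
    unfolding z using assms by (simp add: field_simps)
  ultimately have "z powr \<alpha> + \<alpha> * z powr (\<alpha> - 1) * (x - z) \<le> x powr \<alpha>"
    by simp
  then have "(z powr \<alpha> + \<alpha> * z powr (\<alpha> - 1) * (x - z)) / (\<alpha> - 1) \<le> x powr \<alpha> / (\<alpha> - 1)"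
    using assms by (simp add: divide_right_mono)
  then show ?thesis
    unfolding phi_alpha_def dphi_alpha_def
    by (simp add: diff_divide_distrib add_divide_distrib algebra_simps)
qed

lemma DERIV_phi_one:
  assumes "0 < x"
  shows "(phi_one has_real_derivative ln x) (at x)"
  unfolding phi_one_def[abs_def] using assms
  by (auto intro!: derivative_eq_intros)

lemma DERIV_phi_alpha:
  assumes "0 < x" "1 < \<alpha>"
  shows "(phi_alpha \<alpha> has_real_derivative dphi_alpha \<alpha> x) (at x)"
proof -
  have "(phi_alpha \<alpha> has_real_derivative 1 / (\<alpha> - 1) * (\<alpha> * x powr (\<alpha> - 1) - 1) - 1) (at x)"
    unfolding phi_alpha_def[abs_def] using assms by (auto intro!: derivative_eq_intros)
  then show ?thesis
    unfolding dphi_alpha_def by (simp add: diff_divide_distrib)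
qed

text \<open>The exponent \<open>\<alpha> - 2\<close> is written as \<open>- q\<close> with
  \<open>q = 2 - \<alpha>\<close>, the form that \<open>convex_Phi_powr\<close> expects.\<close>

lemma DERIV_dphi_alpha:
  assumes "0 < x" "1 < \<alpha>"
  shows "(dphi_alpha \<alpha> has_real_derivative \<alpha> * x powr (- (2 - \<alpha>))) (at x)"
proof -
  have "(dphi_alpha \<alpha> has_real_derivative \<alpha> / (\<alpha> - 1) * ((\<alpha> - 1) * x powr (\<alpha> - 1 - 1))) (at x)"
    unfolding dphi_alpha_def[abs_def] using assms
    by (auto intro!: derivative_eq_intros simp del: diff_diff_eq)
  moreover have "\<alpha> - 1 - 1 = - (2 - \<alpha>)" by simp
  ultimately show ?thesis using assms by simp
qed

lemma deriv_phi_one: "0 < x \<Longrightarrow> deriv phi_one x = ln x"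
  by (rule DERIV_imp_deriv[OF DERIV_phi_one])

lemma deriv_phi_alpha: "0 < x \<Longrightarrow> 1 < \<alpha> \<Longrightarrow> deriv (phi_alpha \<alpha>) x = dphi_alpha \<alpha> x"
  by (rule DERIV_imp_deriv[OF DERIV_phi_alpha])

section \<open>Joint convexity of \<open>Phi\<close>\<close>

text \<open>The determinant condition for the Hessian of \<open>(g b - g a) * (b - a)\<close> when \<open>g'\<close> is a multiple of
  \<open>x powr -q\<close>. With \<open>M = 1 - q + q * (b / a)\<close> and \<open>N = 1 - q + q * (a / b)\<close>, the diagonal entries
  are \<open>a powr -q * (1 + M)\<close> and \<open>b powr -q * (1 + N)\<close>, where \<open>M * N \<ge> 1\<close> and \<open>M\<close>, \<open>N\<close> bound the powers
  of the ratios from above.\<close>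

lemma powr_quadratic_form_nonneg:
  fixes a b u v q :: real
  assumes a: "0 < a" and b: "0 < b" and q: "0 \<le> q" "q \<le> 1"
  defines "A \<equiv> a powr (- q)" and "B \<equiv> b powr (- q)"
    and "M \<equiv> 1 - q + q * (b / a)" and "N \<equiv> 1 - q + q * (a / b)"
  shows "2 * u * v * (A + B) \<le> u\<^sup>2 * (A * (1 + M)) + v\<^sup>2 * (B * (1 + N))"
proof -
  have A: "0 < A" and B: "0 < B" using a b by (simp_all add: A_def B_def)
  have "(b / a) powr q \<le> M" unfolding M_def using a b q by (intro powr_le_affine) auto
  moreover have "(b / a) powr q = A / B"
    using a b by (simp add: A_def B_def powr_divide powr_minus field_simps)
  ultimately have M: "A / B \<le> M" by simp
  have "(a / b) powr q \<le> N" unfolding N_def using a b q by (intro powr_le_affine) auto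
  moreover have "(a / b) powr q = B / A"
    using a b by (simp add: A_def B_def powr_divide powr_minus field_simps)
  ultimately have N: "B / A \<le> N" by simp
  have M0: "0 < M" and N0: "0 < N"
    using M N A B by (auto intro: less_le_trans[rotated])
  have "1 \<le> M * N"
  proof -
    have "M * N = 1 + (1 - q) * q * ((a - b)\<^sup>2 / (a * b))"
      unfolding M_def N_def using a b by (simp add: field_simps power2_eq_square)
    moreover have "0 \<le> (1 - q) * q * ((a - b)\<^sup>2 / (a * b))"
      using a b q by simp
    ultimately show ?thesis by linarith
  qed
  then have "A * B * (2 + A / B + B / A) \<le> A * B * (1 + M + N + M * N)"
    using M N A B by (intro mult_left_mono) auto
  moreover have "A * B * (2 + A / B + B / A) = (A + B)\<^sup>2"
    using A B by (simp add: field_simps power2_eq_square)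
  ultimately have det: "(A + B)\<^sup>2 \<le> (A * (1 + M)) * (B * (1 + N))"
    by (simp add: algebra_simps)
  define P Q where "P = A * (1 + M)" and "Q = B * (1 + N)"
  have P: "0 < P" and Q: "0 < Q" using A B M0 N0 by (auto simp: P_def Q_def)
  \<comment> \<open>Completing the square: \<open>P\<close> times the form is a square plus
    \<open>v\<close> squared times the determinant.\<close>
  have "P * (u\<^sup>2 * P + v\<^sup>2 * Q - 2 * u * v * (A + B)) =
      (u * P - v * (A + B))\<^sup>2 + v\<^sup>2 * (P * Q - (A + B)\<^sup>2)"
    by algebra
  also have "\<dots> \<ge> 0" using det by (simp add: P_def Q_def)
  finally have "0 \<le> u\<^sup>2 * P + v\<^sup>2 * Q - 2 * u * v * (A + B)"
    using P by (simp add: zero_le_mult_iff)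
  then show ?thesis by (simp add: P_def Q_def)
qed

text \<open>Convexity is tested on segments: along the segment from \<open>x\<close> to
  \<open>y\<close> the second derivative is the Hessian form in the direction \<open>(u, v)\<close>,
  which \<open>powr_quadratic_form_nonneg\<close> controls.\<close>

lemma convex_Phi_powr:
  fixes g :: "real \<Rightarrow> real"
  assumes g: "\<And>x. 0 < x \<Longrightarrow> (g has_real_derivative K * x powr (- q)) (at x)"
    and K: "0 \<le> K" and q: "0 \<le> q" "q \<le> 1"
  shows "convex_on ({0<..} \<times> {0<..}) (\<lambda>(a, b). (g b - g a) * (b - a))"
proof (rule convex_onI)
  fix t :: real and x y :: "real \<times> real"
  assume t: "0 < t" "t < 1" and xy: "x \<in> {0<..} \<times> {0<..}" "y \<in> {0<..} \<times> {0<..}"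
  obtain x1 x2 y1 y2 where eq: "x = (x1, x2)" "y = (y1, y2)" by (cases x, cases y)
  define a b where "a s = (1 - s) * x1 + s * y1" and "b s = (1 - s) * x2 + s * y2" for s
  define u v where "u = y1 - x1" and "v = y2 - x2"
  have pos: "0 < (1 - s) * p + s * r" if "s \<in> {0..1}" "0 < p" "0 < r" for s p r :: real
    using that by (cases "s = 0") (auto intro!: add_nonneg_pos)
  have ab: "0 < a s" "0 < b s" if "s \<in> {0..1}" for s
    using that xy unfolding a_def b_def eq by (auto intro!: pos)
  have da: "(a has_real_derivative u) (at s)" and db: "(b has_real_derivative v) (at s)" for s
    unfolding a_def b_def u_def v_def by (auto intro!: derivative_eq_intros)
  define h where "h s = (g (b s) - g (a s)) * (b s - a s)" for s
  define h1 where "h1 s = (K * b s powr (- q) * v - K * a s powr (- q) * u) * (b s - a s)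
      + (g (b s) - g (a s)) * (v - u)" for s
  define h2 where "h2 s = (K * (- q) * b s powr (- q - 1) * v * v - K * (- q) * a s powr (- q - 1) * u * u)
      * (b s - a s) + 2 * (K * b s powr (- q) * v - K * a s powr (- q) * u) * (v - u)" for s
  note ga = DERIV_chain2[OF g da] and gb = DERIV_chain2[OF g db]
  have "convex_on {0..1} h"
  proof (rule f''_ge0_imp_convex)
    fix s :: real assume s: "s \<in> {0..1}"
    show "(h has_real_derivative h1 s) (at s)"
      unfolding h_def[abs_def] h1_def using ab[OF s]
      by (auto intro!: derivative_eq_intros ga gb da db)
    show "(h1 has_real_derivative h2 s) (at s)"
      unfolding h1_def[abs_def] h2_def using ab[OF s]
      by (auto intro!: derivative_eq_intros ga gb da db DERIV_fun_powr simp: algebra_simps)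
    define A B where "A = a s powr (- q)" and "B = b s powr (- q)"
    \<comment> \<open>Lowering the exponent by one is division by the base; this produces the ratios
      \<open>b s / a s\<close> and \<open>a s / b s\<close> of the quadratic form.\<close>
    have "a s powr (- q - 1) = A / a s" "b s powr (- q - 1) = B / b s"
      using ab[OF s] by (simp_all add: A_def B_def powr_diff)
    then have "h2 s = K * (u\<^sup>2 * (A * (1 + (1 - q + q * (b s / a s))))
        + v\<^sup>2 * (B * (1 + (1 - q + q * (a s / b s)))) - 2 * u * v * (A + B))"
      unfolding h2_def A_def[symmetric] B_def[symmetric] using ab[OF s]
      by (simp add: field_simps power2_eq_square)
    also have "\<dots> \<ge> 0"
      using powr_quadratic_form_nonneg[OF ab[OF s] q, of u v] K by (simp add: A_def B_def)
    finally show "0 \<le> h2 s" .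
  qed simp
  from convex_onD[OF this, of t 0 1] t
  show "(\<lambda>(a, b). (g b - g a) * (b - a)) ((1 - t) *\<^sub>R x + t *\<^sub>R y)
      \<le> (1 - t) * (\<lambda>(a, b). (g b - g a) * (b - a)) x + t * (\<lambda>(a, b). (g b - g a) * (b - a)) y"
    by (simp add: h_def a_def b_def eq)
qed (intro convex_Times; simp)

text \<open>Tangents give convexity, the horizontal tangent at \<open>1\<close> gives nonnegativity,
  and the power law for the derivative of \<open>\<psi>\<close> gives the joint convexity of
  \<open>Phi\<close>.\<close>

lemma admissibleI:
  fixes \<phi> \<psi> :: "real \<Rightarrow> real"
  assumes tangent: "\<And>x z. 0 \<le> x \<Longrightarrow> 0 < z \<Longrightarrow> \<phi> z + \<psi> z * (x - z) \<le> \<phi> x"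
    and one: "\<phi> 1 = 0" "\<psi> 1 = 0"
    and D\<phi>: "\<And>x. 0 < x \<Longrightarrow> (\<phi> has_real_derivative \<psi> x) (at x)"
    and D\<psi>: "\<And>x. 0 < x \<Longrightarrow> (\<psi> has_real_derivative K * x powr (- q)) (at x)"
    and K: "0 \<le> K" "0 \<le> q" "q \<le> 1"
  shows "admissible \<phi>"
proof -
  have deriv: "deriv \<phi> x = \<psi> x" if "0 < x" for x
    using DERIV_imp_deriv[OF D\<phi>[OF that]] .
  have "\<forall>x\<ge>0. 0 \<le> \<phi> x"
    using tangent[of _ 1] one by simp
  moreover have "convex_on {0..} \<phi>"
    using tangent by (rule convex_on_atLeast0_if_tangents)
  moreover have "\<phi> differentiable (at x) \<and> deriv \<phi> differentiable (at x)" if "0 < x" for x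
  proof
    show "\<phi> differentiable (at x)"
      using D\<phi>[OF that] by (auto simp: real_differentiable_def)
    \<comment> \<open>\<open>deriv \<phi>\<close> and \<open>\<psi>\<close> are known to agree only
      on \<open>{0<..}\<close>, an open neighbourhood of \<open>x\<close>, which is enough to
      transfer the derivative.\<close>
    have "(deriv \<phi> has_real_derivative K * x powr (- q)) (at x)"
      using D\<psi>[OF that] by (rule DERIV_cong_ev[THEN iffD1, rotated -1])
        (use that deriv in \<open>auto simp: eventually_nhds intro!: exI[of _ "{0<..}"]\<close>)
    then show "deriv \<phi> differentiable (at x)"
      by (auto simp: real_differentiable_def)
  qed
  moreover have "convex_on ({0<..} \<times> {0<..}) (\<lambda>(a, b). Phi \<phi> a b)"
    unfolding convex_on_def
  proof (intro conjI ballI allI impI)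
    let ?F = "\<lambda>(a, b). Phi \<phi> a b" and ?C = "{0<..} \<times> {0<..} :: (real \<times> real) set"
    note conv = convex_Phi_powr[OF D\<psi> K]
    then show C: "convex ?C" by (rule convex_on_imp_convex)
    have eq: "?F z = (\<lambda>(a, b). (\<psi> b - \<psi> a) * (b - a)) z" if "z \<in> ?C" for z
      using that by (auto simp: Phi_def deriv)
    fix x y and s t :: real
    assume "x \<in> ?C" "y \<in> ?C" "0 \<le> s" "0 \<le> t" "s + t = 1"
    then show "?F (s *\<^sub>R x + t *\<^sub>R y) \<le> s * ?F x + t * ?F y"
      using conv convexD[OF C] unfolding convex_on_def by (simp only: eq)
  qed
  ultimately show ?thesis
    by (auto simp: admissible_def)
qed

lemma admissible_phi_one: "admissible phi_one"
proof (rule admissibleI[of _ ln 1 1])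
  fix x :: real assume "0 < x"
  then show "(ln has_real_derivative 1 * x powr - 1) (at x)"
    by (auto intro!: derivative_eq_intros simp: powr_minus divide_simps)
qed (use phi_one_tangent DERIV_phi_one in \<open>auto simp: phi_one_def[of 1]\<close>)

lemma admissible_phi_alpha:
  assumes "\<alpha> \<in> {1<..2}"
  shows "admissible (phi_alpha \<alpha>)"
  using assms
  by (intro admissibleI[of _ "dphi_alpha \<alpha>" \<alpha> "2 - \<alpha>"] phi_alpha_tangent
        DERIV_phi_alpha DERIV_dphi_alpha)
    (auto simp: phi_alpha_def dphi_alpha_def diff_divide_distrib[symmetric])

section \<open>One Euler step\<close>

lemma convex_tangent:
  assumes "convex_on {0..} \<phi>" "\<phi> differentiable (at z)" "0 < z" "0 < x"
  shows "\<phi> z + deriv \<phi> z * (x - z) \<le> \<phi> x"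
proof -
  have "(\<phi> has_real_derivative deriv \<phi> z) (at z within {0..})"
    using assms(2) by (metis DERIV_imp_deriv has_field_derivative_at_within real_differentiable_def)
  then have "\<phi> x - \<phi> z \<ge> deriv \<phi> z * (x - z)"
    using assms by (intro convex_on_imp_above_tangent[where A = "{0..}"]) auto
  then show ?thesis by simp
qed

lemma admissible_tangent:
  assumes "admissible \<phi>" "0 < z" "0 < x"
  shows "\<phi> z + deriv \<phi> z * (x - z) \<le> \<phi> x"
  using assms by (intro convex_tangent) (auto simp: admissible_def)

text \<open>Adding the tangent inequalities at \<open>a\<close> and \<open>b\<close> cancels the
  values of \<open>\<phi>\<close>.\<close>

lemma Phi_nonneg:
  assumes "admissible \<phi>" "0 < a" "0 < b"
  shows "0 \<le> Phi \<phi> a b"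
  using admissible_tangent[OF assms] admissible_tangent[OF assms(1,3,2)]
  by (simp add: Phi_def algebra_simps)

text \<open>Jensen's inequality after pooling: the masses \<open>d i\<close> are taken away from the
  points \<open>z i\<close> and joined with the mass \<open>w\<close> at \<open>z0\<close> into one
  atom of mass \<open>W\<close> at their barycentre. The case \<open>d = 0\<close> is plain
  Jensen.\<close>

lemma convex_on_merge:
  fixes F :: "'v::real_vector \<Rightarrow> real" and I :: "'i set"
  assumes F: "convex_on C F" and I: "finite I"
    and z: "z0 \<in> C" "\<And>i. i \<in> I \<Longrightarrow> z i \<in> C"
    and d: "\<And>i. i \<in> I \<Longrightarrow> 0 \<le> d i" "\<And>i. i \<in> I \<Longrightarrow> d i \<le> q i"
    and dF: "\<And>i. i \<in> I \<Longrightarrow> 0 \<le> d i * F (z i)"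
    and w: "0 < w" "w + sum q I = 1"
  defines "W \<equiv> w + sum d I"
  shows "F (w *\<^sub>R z0 + (\<Sum>i\<in>I. q i *\<^sub>R z i))
    \<le> W * F ((1 / W) *\<^sub>R (w *\<^sub>R z0 + (\<Sum>i\<in>I. d i *\<^sub>R z i))) + (\<Sum>i\<in>I. q i * F (z i))"
proof -
  have W: "0 < W" using w d by (auto simp: W_def intro!: add_pos_nonneg sum_nonneg)
  \<comment> \<open>The index \<open>None\<close> stands for the extra point \<open>z0\<close>, and
    in the second combination below for the barycentre \<open>y0\<close>.\<close>
  define a y where "a = case_option w d" and "y = case_option z0 z"
  define J where "J = insert None (Some ` I)"
  have sumJ: "(\<Sum>j\<in>J. g j) = g None + (\<Sum>i\<in>I. g (Some i))" for g :: "'i option \<Rightarrow> 'c::comm_monoid_add"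
    using I by (simp add: J_def sum.reindex)
  define y0 where "y0 = (1 / W) *\<^sub>R (w *\<^sub>R z0 + (\<Sum>i\<in>I. d i *\<^sub>R z i))"
  have C: "convex C" using F by (rule convex_on_imp_convex)
  have "(\<Sum>j\<in>J. (a j / W) *\<^sub>R y j) \<in> C"
  proof (rule convex_sum[OF _ C])
    show "(\<Sum>j\<in>J. a j / W) = 1"
      using W unfolding sumJ by (simp add: a_def W_def sum_divide_distrib[symmetric] add_divide_distrib[symmetric])
  qed (use I z d w W in \<open>auto simp: J_def a_def y_def\<close>)
  also have "(\<Sum>j\<in>J. (a j / W) *\<^sub>R y j) = y0"
    unfolding sumJ by (simp add: a_def y_def y0_def scaleR_add_right scaleR_sum_right)
  finally have y0: "y0 \<in> C" .
  define a' y' where "a' = case_option W (\<lambda>i. q i - d i)" and "y' = case_option y0 z"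
  have "F (\<Sum>j\<in>J. a' j *\<^sub>R y' j) \<le> (\<Sum>j\<in>J. a' j * F (y' j))"
  proof (rule convex_on_sum[OF _ _ F])
    show "(\<Sum>j\<in>J. a' j) = 1"
      using w(2) by (simp add: sumJ a'_def W_def sum_subtractf)
  qed (use I y0 z d W in \<open>auto simp: J_def a'_def y'_def\<close>)
  moreover have "(\<Sum>j\<in>J. a' j *\<^sub>R y' j) = w *\<^sub>R z0 + (\<Sum>i\<in>I. q i *\<^sub>R z i)"
    using W by (simp add: sumJ a'_def y'_def y0_def scaleR_left_diff_distrib sum_subtractf)
  \<comment> \<open>Only the mass \<open>q i - d i\<close> is left at \<open>z i\<close>; the terms
    \<open>d i * F (z i)\<close> added on the right are nonnegative.\<close>
  moreover have "(\<Sum>j\<in>J. a' j * F (y' j)) \<le> W * F y0 + (\<Sum>i\<in>I. q i * F (z i))"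
    using dF by (auto simp: sumJ a'_def y'_def left_diff_distrib intro!: sum_mono)
  ultimately show ?thesis
    by (simp add: y0_def)
qed

text \<open>A function of one copy sees only the corresponding marginal of the coupling. The
  coupling conditions do not prescribe the marginal rate of the null move, but its gradient
  vanishes.\<close>

lemma coupling_generator:
  assumes "coupling_rates G c \<eta> \<eta>' q" "finite G"
  shows "(\<Sum>(\<gamma>, \<gamma>')\<in>Gstar G \<times> Gstar G. q \<gamma> \<gamma>' * (f (act \<gamma> \<eta>) - f \<eta>)) = generator G c f \<eta>"
    and "(\<Sum>(\<gamma>, \<gamma>')\<in>Gstar G \<times> Gstar G. q \<gamma> \<gamma>' * (f (act \<gamma>' \<eta>') - f \<eta>')) = generator G c f \<eta>'"
proof -
  have G: "(\<Sum>\<gamma>\<in>Gstar G. X \<gamma> * (f (act \<gamma> x) - f x)) = (\<Sum>\<gamma>\<in>G. X (Some \<gamma>) * grad \<gamma> f x)" for X x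
    using assms(2) by (simp add: Gstar_def sum.reindex act_def grad_def)
  have "(\<Sum>(\<gamma>, \<gamma>')\<in>Gstar G \<times> Gstar G. q \<gamma> \<gamma>' * (f (act \<gamma> \<eta>) - f \<eta>)) =
      (\<Sum>\<gamma>\<in>Gstar G. (\<Sum>\<gamma>'\<in>Gstar G. q \<gamma> \<gamma>') * (f (act \<gamma> \<eta>) - f \<eta>))"
    by (simp add: sum.cartesian_product[symmetric] sum_distrib_right)
  then show "(\<Sum>(\<gamma>, \<gamma>')\<in>Gstar G \<times> Gstar G. q \<gamma> \<gamma>' * (f (act \<gamma> \<eta>) - f \<eta>)) = generator G c f \<eta>"
    using assms(1) unfolding G by (simp add: generator_def coupling_rates_def)
  have "(\<Sum>(\<gamma>, \<gamma>')\<in>Gstar G \<times> Gstar G. q \<gamma> \<gamma>' * (f (act \<gamma>' \<eta>') - f \<eta>')) =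
      (\<Sum>\<gamma>'\<in>Gstar G. (\<Sum>\<gamma>\<in>Gstar G. q \<gamma> \<gamma>') * (f (act \<gamma>' \<eta>') - f \<eta>'))"
    by (simp add: sum.cartesian_product[symmetric] sum_distrib_right) (rule sum.swap)
  then show "(\<Sum>(\<gamma>, \<gamma>')\<in>Gstar G \<times> Gstar G. q \<gamma> \<gamma>' * (f (act \<gamma>' \<eta>') - f \<eta>')) = generator G c f \<eta>'"
    using assms(1) unfolding G by (simp add: generator_def coupling_rates_def)
qed

definition euler :: "'a move set \<Rightarrow> ('a \<Rightarrow> 'a move \<Rightarrow> real) \<Rightarrow> real \<Rightarrow> ('a \<Rightarrow> real) \<Rightarrow> 'a \<Rightarrow> real" where
  "euler G c h f \<eta> = f \<eta> + h * generator G c f \<eta>"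

text \<open>The Euler step moves \<open>(f \<eta>, f \<eta>')\<close> to its average over the coupled moves. The part \<open>d\<close> of the
  coupling rates that leads to the diagonal, where \<open>Phi\<close> vanishes, is merged with the mass remaining
  at \<open>(f \<eta>, f \<eta>')\<close> before Jensen's inequality is applied; the hypothesis \<open>gain\<close> quantifies the
  decrease of \<open>Phi\<close> through the merging.\<close>

lemma Phi_euler_le:
  fixes f :: "'a \<Rightarrow> real"
  assumes q: "coupling_rates G c \<eta> \<eta>' q" and G: "finite G"
    and adm: "admissible \<phi>" and f: "\<And>x. 0 < f x"
    and h: "0 \<le> h" "h * (\<Sum>(\<gamma>, \<gamma>')\<in>Gstar G \<times> Gstar G. q \<gamma> \<gamma>') < 1"
    and d: "\<And>\<gamma> \<gamma>'. \<gamma> \<in> Gstar G \<Longrightarrow> \<gamma>' \<in> Gstar G \<Longrightarrow> 0 \<le> d \<gamma> \<gamma>' \<and> d \<gamma> \<gamma>' \<le> q \<gamma> \<gamma>' \<and>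
      (d \<gamma> \<gamma>' \<noteq> 0 \<longrightarrow> act \<gamma> \<eta> = act \<gamma>' \<eta>')"
  defines "w \<equiv> 1 - h * (\<Sum>(\<gamma>, \<gamma>')\<in>Gstar G \<times> Gstar G. q \<gamma> \<gamma>')"
    and "D \<equiv> h * (\<Sum>(\<gamma>, \<gamma>')\<in>Gstar G \<times> Gstar G. d \<gamma> \<gamma>')"
    and "s \<equiv> h * (\<Sum>(\<gamma>, \<gamma>')\<in>Gstar G \<times> Gstar G. d \<gamma> \<gamma>' * f (act \<gamma> \<eta>))"
  assumes gain: "(w + D) * Phi \<phi> ((w * f \<eta> + s) / (w + D)) ((w * f \<eta>' + s) / (w + D))
      \<le> w * (1 - h * \<mu>) * Phi \<phi> (f \<eta>) (f \<eta>')"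
  shows "Phi \<phi> (euler G c h f \<eta>) (euler G c h f \<eta>')
    \<le> Phi \<phi> (f \<eta>) (f \<eta>')
      + h * (\<Sum>\<gamma>\<in>Gstar G. \<Sum>\<gamma>'\<in>Gstar G. q \<gamma> \<gamma>' * grad2 \<gamma> \<gamma>' (f_phi \<phi> f) \<eta> \<eta>')
      - h * \<mu> * w * Phi \<phi> (f \<eta>) (f \<eta>')"
proof -
  let ?I = "Gstar G \<times> Gstar G"
  let ?F = "\<lambda>(a, b). Phi \<phi> a b"
  let ?z = "\<lambda>(\<gamma>, \<gamma>'). (f (act \<gamma> \<eta>), f (act \<gamma>' \<eta>'))"
  define Q where "Q = (\<Sum>(\<gamma>, \<gamma>')\<in>?I. q \<gamma> \<gamma>')"
  have I: "finite ?I" using G by (simp add: Gstar_def)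
  have e1: "euler G c h f \<eta> = w * f \<eta> + (\<Sum>(\<gamma>, \<gamma>')\<in>?I. h * q \<gamma> \<gamma>' * f (act \<gamma> \<eta>))"
    unfolding euler_def coupling_generator(1)[OF q G, symmetric] w_def
    by (simp add: sum_distrib_left sum_distrib_right split_beta algebra_simps sum_subtractf)
  have e2: "euler G c h f \<eta>' = w * f \<eta>' + (\<Sum>(\<gamma>, \<gamma>')\<in>?I. h * q \<gamma> \<gamma>' * f (act \<gamma>' \<eta>'))"
    unfolding euler_def coupling_generator(2)[OF q G, symmetric] w_def
    by (simp add: sum_distrib_left sum_distrib_right split_beta algebra_simps sum_subtractf)
  have s1: "(\<Sum>i\<in>?I. h * d (fst i) (snd i) * f (act (fst i) \<eta>)) = s"
    by (simp add: s_def sum_distrib_left split_beta mult.assoc)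
  \<comment> \<open>Where \<open>d\<close> is nonzero both copies land on the same state, so both
    coordinates receive the same contribution \<open>s\<close>.\<close>
  moreover have "(\<Sum>i\<in>?I. h * d (fst i) (snd i) * f (act (fst i) \<eta>)) =
      (\<Sum>i\<in>?I. h * d (fst i) (snd i) * f (act (snd i) \<eta>'))"
    using d by (intro sum.cong) fastforce+
  ultimately have s2: "(\<Sum>i\<in>?I. h * d (fst i) (snd i) * f (act (snd i) \<eta>')) = s"
    by simp
  have "?F (w *\<^sub>R (f \<eta>, f \<eta>') + (\<Sum>i\<in>?I. (h * case_prod q i) *\<^sub>R ?z i))
      \<le> (w + (\<Sum>i\<in>?I. h * case_prod d i)) *
        ?F ((1 / (w + (\<Sum>i\<in>?I. h * case_prod d i))) *\<^sub>R
          (w *\<^sub>R (f \<eta>, f \<eta>') + (\<Sum>i\<in>?I. (h * case_prod d i) *\<^sub>R ?z i)))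
        + (\<Sum>i\<in>?I. (h * case_prod q i) * ?F (?z i))"
  proof (rule convex_on_merge[OF _ I])
    show "convex_on ({0<..} \<times> {0<..}) ?F" using adm by (simp add: admissible_def)
    show "0 < w" using h by (simp add: w_def)
    show "w + (\<Sum>i\<in>?I. h * case_prod q i) = 1"
      by (simp add: w_def sum_distrib_left)
    show "0 \<le> h * case_prod d i" "h * case_prod d i \<le> h * case_prod q i" if "i \<in> ?I" for i
      using that d h by (auto intro!: mult_left_mono)
    show "0 \<le> h * case_prod d i * ?F (?z i)" if "i \<in> ?I" for i
      using that d h Phi_nonneg[OF adm f f] by (auto intro!: mult_nonneg_nonneg)
  qed (use f in auto)
  also have "(\<Sum>i\<in>?I. h * case_prod d i) = D"
    by (simp add: D_def sum_distrib_left)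
  also have "w *\<^sub>R (f \<eta>, f \<eta>') + (\<Sum>i\<in>?I. (h * case_prod d i) *\<^sub>R ?z i) = (w * f \<eta> + s, w * f \<eta>' + s)"
    by (simp add: prod_eq_iff fst_sum snd_sum split_beta s1 s2)
  also have "w *\<^sub>R (f \<eta>, f \<eta>') + (\<Sum>i\<in>?I. (h * case_prod q i) *\<^sub>R ?z i)
      = (euler G c h f \<eta>, euler G c h f \<eta>')"
    unfolding e1 e2 by (simp add: prod_eq_iff fst_sum snd_sum split_beta)
  finally have "Phi \<phi> (euler G c h f \<eta>) (euler G c h f \<eta>')
      \<le> (w + D) * Phi \<phi> ((w * f \<eta> + s) / (w + D)) ((w * f \<eta>' + s) / (w + D))
        + h * (\<Sum>(\<gamma>, \<gamma>')\<in>?I. q \<gamma> \<gamma>' * f_phi \<phi> f (act \<gamma> \<eta>) (act \<gamma>' \<eta>'))"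
    by (simp add: split_beta sum_distrib_left f_phi_def mult.assoc)
  moreover have "(\<Sum>\<gamma>\<in>Gstar G. \<Sum>\<gamma>'\<in>Gstar G. q \<gamma> \<gamma>' * grad2 \<gamma> \<gamma>' (f_phi \<phi> f) \<eta> \<eta>') =
      (\<Sum>(\<gamma>, \<gamma>')\<in>?I. q \<gamma> \<gamma>' * f_phi \<phi> f (act \<gamma> \<eta>) (act \<gamma>' \<eta>')) - Q * Phi \<phi> (f \<eta>) (f \<eta>')"
    by (simp add: sum.cartesian_product grad2_def right_diff_distrib split_beta sum_subtractf
        Q_def sum_distrib_right f_phi_def)
  \<comment> \<open>Here \<open>P\<close> is the old value of \<open>Phi\<close> and
    \<open>R\<close> the sum after the coupled moves; the identity uses
    \<open>w = 1 - h * Q\<close>.\<close>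
  moreover have "w * (1 - h * \<mu>) * P + h * R = P + h * (R - Q * P) - h * \<mu> * w * P" for P R
    unfolding w_def Q_def[symmetric] by algebra
  ultimately show ?thesis
    using gain by (smt (verit))
qed

section \<open>Gain from pooling for \<open>phi_alpha\<close> and \<open>phi_one\<close>\<close>

text \<open>Increments of a concave power over an interval of fixed length decrease as the interval
  moves to the right.\<close>

lemma powr_diff_shift_le:
  fixes A B s r :: real
  assumes "0 < A" "A \<le> B" "0 \<le> s" "0 \<le> r" "r \<le> 1"
  shows "(B + s) powr r - (A + s) powr r \<le> B powr r - A powr r"
proof -
  have "(B + s) powr r - (A + s) powr r \<le> (B + 0) powr r - (A + 0) powr r"
  proof (rule DERIV_nonpos_imp_nonincreasing[OF assms(3)], intro exI conjI)
    fix x :: real assume x: "0 \<le> x"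
    show "((\<lambda>s. (B + s) powr r - (A + s) powr r) has_real_derivative
        (r * (B + x) powr (r - 1) - r * (A + x) powr (r - 1))) (at x)"
      using assms x by (auto intro!: derivative_eq_intros simp: add_pos_nonneg)
    have "(B + x) powr (r - 1) \<le> (A + x) powr (r - 1)"
      using assms x by (intro powr_mono2') auto
    then show "r * (B + x) powr (r - 1) - r * (A + x) powr (r - 1) \<le> 0"
      using assms by (simp add: mult_left_mono)
  qed
  then show ?thesis by simp
qed

lemma Phi_phi_alpha:
  assumes "0 < a" "0 < b" "1 < \<alpha>"
  shows "Phi (phi_alpha \<alpha>) a b = \<alpha> / (\<alpha> - 1) * ((b powr (\<alpha> - 1) - a powr (\<alpha> - 1)) * (b - a))"
proof -
  have "dphi_alpha \<alpha> b - dphi_alpha \<alpha> a = \<alpha> / (\<alpha> - 1) * (b powr (\<alpha> - 1) - a powr (\<alpha> - 1))"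
    by (simp add: dphi_alpha_def right_diff_distrib)
  with assms show ?thesis
    by (simp only: Phi_def deriv_phi_alpha mult.assoc)
qed

lemma Phi_phi_one:
  assumes "0 < a" "0 < b"
  shows "Phi phi_one a b = (ln b - ln a) * (b - a)"
  using assms by (simp add: Phi_def deriv_phi_one)

lemma Phi_commute: "Phi \<phi> a b = Phi \<phi> b a"
  by (simp add: Phi_def algebra_simps)

text \<open>Pooling acts on both arguments by the same affine map with slope
  \<open>t = w / W\<close> and shift \<open>u\<close>. The shift only lowers the difference of the
  powers, and the slope contributes \<open>t powr r \<le> 1 - r * D\<close>. The location of the
  pooled mass enters only through the sign of \<open>s\<close>.\<close>

lemma Phi_alpha_merge:
  assumes \<alpha>: "\<alpha> \<in> {1<..2}" and ab: "0 < a" "0 < b"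
    and w: "0 < w" "0 \<le> D" "w + D \<le> 1" and s: "0 \<le> s"
  shows "(w + D) * Phi (phi_alpha \<alpha>) ((w * a + s) / (w + D)) ((w * b + s) / (w + D))
    \<le> w * (1 - (\<alpha> - 1) * D) * Phi (phi_alpha \<alpha>) a b"
  using ab
proof (induction a b rule: linorder_wlog)
  case (sym a b)
  then show ?case by (metis Phi_commute)
next
  case (le a b)
  define W r t u where "W = w + D" and "r = \<alpha> - 1" and "t = w / W" and "u = s / W"
  have r: "0 < r" "r \<le> 1" using \<alpha> by (auto simp: r_def)
  have W: "0 < W" "W \<le> 1" and u: "0 \<le> u" using w s by (auto simp: W_def u_def)
  have t: "0 < t" using w W by (simp add: t_def)
  \<comment> \<open>\<open>1 - t\<close> equals \<open>D / W\<close>, which is at least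
    \<open>D\<close> because \<open>W \<le> 1\<close>.\<close>
  have "D * 1 \<le> D / W"
    using W w by (simp add: pos_le_divide_eq mult_left_le)
  then have tD: "t \<le> 1 - D"
    using W by (simp add: t_def W_def field_simps)
  have eq: "(w * x + s) / W = t * x + u" for x by (simp add: t_def u_def add_divide_distrib)
  have "(t * b + u) powr r - (t * a + u) powr r \<le> (t * b) powr r - (t * a) powr r"
    using le r t u by (intro powr_diff_shift_le) auto
  also have "\<dots> = t powr r * (b powr r - a powr r)"
    using le t by (simp add: powr_mult right_diff_distrib)
  also have "\<dots> \<le> (1 - r * D) * (b powr r - a powr r)"
  proof (rule mult_right_mono)
    have "t powr r \<le> 1 - r + r * t" using t r by (intro powr_le_affine) auto
    also have "\<dots> \<le> 1 - r + r * (1 - D)" using r tD by auto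
    finally show "t powr r \<le> 1 - r * D" by (simp add: algebra_simps)
    show "0 \<le> b powr r - a powr r" using le r by (simp add: powr_mono2)
  qed
  finally have "\<alpha> / r * w * (b - a) * ((t * b + u) powr r - (t * a + u) powr r) \<le>
      \<alpha> / r * w * (b - a) * ((1 - r * D) * (b powr r - a powr r))"
    using \<alpha> r w le by (intro mult_left_mono) auto
  moreover have "W * Phi (phi_alpha \<alpha>) (t * a + u) (t * b + u) =
      \<alpha> / r * (W * t) * (b - a) * ((t * b + u) powr r - (t * a + u) powr r)"
  proof -
    have pos: "0 < t * a + u" "0 < t * b + u" using t u le by (auto intro!: add_pos_nonneg)
    have "t * b + u - (t * a + u) = t * (b - a)" by (simp add: algebra_simps)
    moreover have "1 < \<alpha>" using \<alpha> by simp
    ultimately show ?thesis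
      by (simp only: Phi_phi_alpha[OF pos] r_def) simp
  qed
  moreover have "W * t = w" using W by (simp add: t_def)
  moreover have "Phi (phi_alpha \<alpha>) a b = \<alpha> / r * ((b powr r - a powr r) * (b - a))"
    using \<alpha> le by (simp add: Phi_phi_alpha r_def)
  ultimately show ?case
    unfolding W_def[symmetric] eq r_def[symmetric] by (simp add: ac_simps)
qed

text \<open>Convexity of \<open>artanh\<close>, up to the factor 2 and a rescaling.\<close>

lemma ln_quotient_le:
  fixes s e t :: real
  assumes "0 \<le> e" "e < s" "0 \<le> t" "t \<le> 1"
  shows "ln (s + t * e) - ln (s - t * e) \<le> t * (ln (s + e) - ln (s - e))"
proof -
  define k where "k x = ln (s + x * e) - ln (s - x * e)" for x
  have pos: "0 < s - x * e" "0 < s + x * e" if "x \<in> {0..1}" for x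
  proof -
    have "x * e \<le> 1 * e" "0 \<le> x * e" using that assms by (intro mult_right_mono mult_nonneg_nonneg; simp)+
    then show "0 < s - x * e" "0 < s + x * e" using assms by auto
  qed
  have "convex_on {0..1} k"
  proof (rule f''_ge0_imp_convex)
    fix x :: real assume x: "x \<in> {0..1}"
    show "(k has_real_derivative e / (s + x * e) + e / (s - x * e)) (at x)"
      unfolding k_def[abs_def] using pos[OF x] by (auto intro!: derivative_eq_intros)
    show "((\<lambda>x. e / (s + x * e) + e / (s - x * e)) has_real_derivative
        (e\<^sup>2 / (s - x * e)\<^sup>2 - e\<^sup>2 / (s + x * e)\<^sup>2)) (at x)"
      using pos[OF x] by (auto intro!: derivative_eq_intros simp: power2_eq_square)
    have "e\<^sup>2 / (s + x * e)\<^sup>2 \<le> e\<^sup>2 / (s - x * e)\<^sup>2"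
      using pos[OF x] x assms by (intro divide_left_mono power_mono mult_pos_pos) auto
    then show "0 \<le> e\<^sup>2 / (s - x * e)\<^sup>2 - e\<^sup>2 / (s + x * e)\<^sup>2" by simp
  qed simp
  \<comment> \<open>Since \<open>k 0 = 0\<close>, convexity gives
    \<open>k t \<le> t * k 1\<close>.\<close>
  from convex_onD[OF this, of t 0 1] assms show ?thesis by (simp add: k_def)
qed

text \<open>Equal masses \<open>k\<close> sit at \<open>a\<close> and at \<open>b\<close>
  themselves, so pooling shrinks the pair towards its midpoint by the factor
  \<open>t = w / W\<close>. By \<open>ln_quotient_le\<close> the difference of logarithms then
  shrinks at least by \<open>t\<close>, and \<open>t \<le> 1 - 2 * k\<close>.\<close>

lemma Phi_one_merge:
  assumes ab: "0 < a" "0 < b" and w: "0 < w" "0 \<le> k" "w + 2 * k \<le> 1"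
  defines "s \<equiv> k * (a + b)"
  shows "(w + 2 * k) * Phi phi_one ((w * a + s) / (w + 2 * k)) ((w * b + s) / (w + 2 * k))
    \<le> w * (1 - 2 * k) * Phi phi_one a b"
  using ab unfolding s_def
proof (induction a b rule: linorder_wlog)
  case (sym a b)
  then show ?case by (metis Phi_commute add.commute)
next
  case (le a b)
  \<comment> \<open>From here \<open>s\<close> is the midpoint of \<open>a\<close> and
    \<open>b\<close>, and \<open>e\<close> half their distance.\<close>
  define W t s e where "W = w + 2 * k" and "t = w / W" and "s = (a + b) / 2" and "e = (b - a) / 2"
  have W: "0 < W" "W \<le> 1" using w by (auto simp: W_def)
  have t: "0 < t" "t \<le> 1" using w W by (auto simp: t_def W_def)
  have "(2 * k) * 1 \<le> (2 * k) / W"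
    using W w by (simp add: pos_le_divide_eq mult_left_le)
  then have tk: "t \<le> 1 - 2 * k"
    using W by (simp add: t_def W_def field_simps)
  have eq: "(w * a + k * (a + b)) / W = s - t * e" "(w * b + k * (a + b)) / W = s + t * e"
    using W by (simp_all add: t_def s_def e_def field_simps) (simp_all add: W_def algebra_simps)
  have "e < s" using le by (simp add: s_def e_def)
  have "t * e \<le> 1 * e" "0 \<le> t * e" using t le by (intro mult_right_mono mult_nonneg_nonneg; simp add: e_def)+
  then have pos: "0 < s - t * e" "0 < s + t * e" using \<open>e < s\<close> by auto
  have "ln (s + t * e) - ln (s - t * e) \<le> t * (ln (s + e) - ln (s - e))"
    using le t by (intro ln_quotient_le) (auto simp: s_def e_def)
  also have "\<dots> = t * (ln b - ln a)"
    by (simp add: s_def e_def field_simps)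
  also have "\<dots> \<le> (1 - 2 * k) * (ln b - ln a)"
    using tk le by (intro mult_right_mono) auto
  finally have "w * (b - a) * (ln (s + t * e) - ln (s - t * e)) \<le> w * (b - a) * ((1 - 2 * k) * (ln b - ln a))"
    using w le by (intro mult_left_mono) auto
  moreover have "W * Phi phi_one (s - t * e) (s + t * e) = (W * t) * (b - a) * (ln (s + t * e) - ln (s - t * e))"
    unfolding Phi_phi_one[OF pos] by (simp add: e_def algebra_simps)
  moreover have "W * t = w" using W by (simp add: t_def)
  ultimately show ?case
    unfolding W_def[symmetric] eq using le by (simp add: Phi_phi_one ac_simps)
qed

section \<open>Entropy decay along the Euler scheme\<close>

locale reversible_chain =
  fixes G :: "('a::finite \<Rightarrow> 'a) set"
    and c :: "'a \<Rightarrow> ('a \<Rightarrow> 'a) \<Rightarrow> real"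
    and m :: "'a pmf"
    and \<iota> :: "('a \<Rightarrow> 'a) \<Rightarrow> ('a \<Rightarrow> 'a)"
  assumes rates: "transition_rates G c"
    and irr: "Irr G c m"
    and rev: "Rev G c m \<iota>"
begin

section \<open>Symmetric form of the Dirichlet energy and positivity of the measure\<close>

lemma finite_G: "finite G"
  using irr by (simp add: Irr_def)

lemma c_nonneg: "\<sigma> \<in> G \<Longrightarrow> 0 \<le> c \<eta> \<sigma>"
  using rates by (simp add: transition_rates_def)

lemma finite_active: "finite (active_pairs G c)"
  by (rule finite_subset[of _ "UNIV \<times> G"]) (auto simp: active_pairs_def finite_G)

lemma sum_active:
  "(\<Sum>(\<eta>, \<sigma>)\<in>active_pairs G c. c \<eta> \<sigma> * X \<eta> \<sigma>) = (\<Sum>\<eta>\<in>UNIV. \<Sum>\<sigma>\<in>G. c \<eta> \<sigma> * X \<eta> \<sigma>)"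
  unfolding sum.cartesian_product
proof (rule sum.mono_neutral_left)
  show "\<forall>i\<in>UNIV \<times> G - active_pairs G c. (case i of (\<eta>, \<sigma>) \<Rightarrow> c \<eta> \<sigma> * X \<eta> \<sigma>) = 0"
  proof
    fix i assume i: "i \<in> UNIV \<times> G - active_pairs G c"
    then have "c (fst i) (snd i) = 0"
      using c_nonneg[of "snd i" "fst i"] by (auto simp: active_pairs_def)
    then show "(case i of (\<eta>, \<sigma>) \<Rightarrow> c \<eta> \<sigma> * X \<eta> \<sigma>) = 0" by (simp add: split_beta)
  qed
qed (auto simp: active_pairs_def finite_G)

text \<open>Reversibility with \<open>F \<eta> \<sigma> = g \<eta> * (f (\<sigma> \<eta>) - f
  \<eta>)\<close> gives a second expression for the energy; the claim is the average of the
  two.\<close>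

lemma dirichlet_eq:
  "dirichlet G c m f g =
    1 / 2 * (\<Sum>(\<eta>, \<sigma>)\<in>active_pairs G c. c \<eta> \<sigma> * ((f (\<sigma> \<eta>) - f \<eta>) * (g (\<sigma> \<eta>) - g \<eta>) * pmf m \<eta>))"
proof -
  let ?T = "\<lambda>F. \<Sum>\<eta>\<in>UNIV. \<Sum>\<sigma>\<in>G. F \<eta> \<sigma> * c \<eta> \<sigma> * pmf m \<eta>"
  let ?F = "\<lambda>\<eta> \<sigma>. g \<eta> * (f (\<sigma> \<eta>) - f \<eta>)"
  have D: "dirichlet G c m f g = - ?T ?F"
    by (simp add: dirichlet_def generator_def grad_def sum_distrib_left sum_distrib_right ac_simps)
  have "bounded ((\<lambda>(\<eta>, \<sigma>). ?F \<eta> \<sigma>) ` (UNIV \<times> G))"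
    using finite_G by (intro finite_imp_bounded) auto
  then have "?T ?F = ?T (\<lambda>\<eta> \<sigma>. ?F (\<sigma> \<eta>) (\<iota> \<sigma>))"
    using rev unfolding Rev_def by blast
  also have "\<dots> = ?T (\<lambda>\<eta> \<sigma>. g (\<sigma> \<eta>) * (f \<eta> - f (\<sigma> \<eta>)))"
  proof (intro sum.cong refl)
    fix \<eta> \<sigma> assume \<sigma>: "\<sigma> \<in> G"
    show "g (\<sigma> \<eta>) * (f (\<iota> \<sigma> (\<sigma> \<eta>)) - f (\<sigma> \<eta>)) * c \<eta> \<sigma> * pmf m \<eta> =
        g (\<sigma> \<eta>) * (f \<eta> - f (\<sigma> \<eta>)) * c \<eta> \<sigma> * pmf m \<eta>"
    proof (cases "pmf m \<eta> * c \<eta> \<sigma> > 0")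
      case True
      then have "\<iota> \<sigma> (\<sigma> \<eta>) = \<eta>" using rev \<sigma> unfolding Rev_def by blast
      then show ?thesis by simp
    next
      \<comment> \<open>Where \<open>\<iota> \<sigma>\<close> is not known to undo
        \<open>\<sigma>\<close>, the weight of the term is zero.\<close>
      case False
      moreover have "0 \<le> pmf m \<eta> * c \<eta> \<sigma>" using c_nonneg[OF \<sigma>] by simp
      ultimately show ?thesis by auto
    qed
  qed
  finally have "?T ?F = ?T (\<lambda>\<eta> \<sigma>. g (\<sigma> \<eta>) * (f \<eta> - f (\<sigma> \<eta>)))" .
  moreover have "(\<Sum>\<eta>\<in>UNIV. \<Sum>\<sigma>\<in>G. c \<eta> \<sigma> * ((f (\<sigma> \<eta>) - f \<eta>) * (g (\<sigma> \<eta>) - g \<eta>) * pmf m \<eta>)) =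
      - ?T (\<lambda>\<eta> \<sigma>. g (\<sigma> \<eta>) * (f \<eta> - f (\<sigma> \<eta>))) - ?T ?F"
    unfolding sum_subtractf[symmetric] sum_negf[symmetric]
    by (intro sum.cong refl) algebra
  ultimately show ?thesis
    unfolding D sum_active by simp
qed

lemma dirichlet_commute: "dirichlet G c m f g = dirichlet G c m g f"
  unfolding dirichlet_eq by (simp add: ac_simps)

lemma energy_eq:
  "dirichlet G c m (\<lambda>\<eta>. deriv \<phi> (f \<eta>)) f =
    1 / 2 * (\<Sum>(\<eta>, \<sigma>)\<in>active_pairs G c. c \<eta> \<sigma> * (Phi \<phi> (f \<eta>) (f (\<sigma> \<eta>)) * pmf m \<eta>))"
  unfolding dirichlet_eq by (simp add: Phi_def)

lemma energy_nonneg: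
  assumes "admissible \<phi>" "\<And>\<eta>. 0 < f \<eta>"
  shows "0 \<le> dirichlet G c m (\<lambda>\<eta>. deriv \<phi> (f \<eta>)) f"
  unfolding energy_eq
  by (intro mult_nonneg_nonneg sum_nonneg)
    (auto simp: active_pairs_def c_nonneg Phi_nonneg[OF assms(1)] assms(2))

lemma sum_generator_eq_0: "(\<Sum>\<eta>\<in>UNIV. generator G c f \<eta> * pmf m \<eta>) = 0"
  using irr by (simp add: Irr_def invariant_measure_def)

text \<open>The indicator of \<open>\<sigma> \<eta>\<close> has nonnegative generator off the point \<open>\<sigma> \<eta>\<close>, so a null state has no
  active move from a charged one.\<close>

lemma pmf_pos_step:
  assumes "0 < pmf m \<eta>" "(\<eta>, \<sigma>) \<in> active_pairs G c"
  shows "0 < pmf m (\<sigma> \<eta>)"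
proof (rule ccontr)
  define f where "f \<xi> = (if \<xi> = \<sigma> \<eta> then 1 else 0 :: real)" for \<xi>
  assume "\<not> 0 < pmf m (\<sigma> \<eta>)"
  then have 0: "pmf m (\<sigma> \<eta>) = 0" using pmf_nonneg[of m "\<sigma> \<eta>"] by linarith
  then have ne: "\<eta> \<noteq> \<sigma> \<eta>" using assms(1) by auto
  have nonneg: "0 \<le> c \<xi> \<tau> * grad \<tau> f \<xi>" if "\<xi> \<noteq> \<sigma> \<eta>" "\<tau> \<in> G" for \<xi> \<tau>
    using that c_nonneg by (auto simp: grad_def f_def)
  have "0 < c \<eta> \<sigma> * grad \<sigma> f \<eta>"
    using assms(2) ne by (auto simp: grad_def f_def active_pairs_def)
  then have "0 < generator G c f \<eta>"
    unfolding generator_def using nonneg ne assms(2) finite_G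
    by (intro sum_pos2[of _ \<sigma>]) (auto simp: active_pairs_def)
  then have "0 < (\<Sum>\<xi>\<in>UNIV. generator G c f \<xi> * pmf m \<xi>)"
  proof (intro sum_pos2[of _ \<eta>])
    fix \<xi>
    show "0 \<le> generator G c f \<xi> * pmf m \<xi>"
    proof (cases "\<xi> = \<sigma> \<eta>")
      case False
      then have "0 \<le> generator G c f \<xi>"
        unfolding generator_def by (intro sum_nonneg nonneg)
      then show ?thesis by simp
    qed (use 0 in simp)
  qed (use assms in auto)
  then show False by (simp add: sum_generator_eq_0)
qed

lemma reachable:
  "(\<eta>, \<eta>') \<in> ((\<lambda>(\<xi>, \<sigma>). (\<xi>, \<sigma> \<xi>)) ` active_pairs G c)\<^sup>*"
  using irr by (simp add: Irr_def irreducible_rates_def)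

text \<open>Positivity spreads from a charged state along paths of active moves. It makes every
  active edge carry positive weight and lets \<open>\<iota> \<sigma>\<close> undo
  \<open>\<sigma>\<close> on every active pair.\<close>

lemma pmf_pos: "0 < pmf m \<eta>"
proof -
  obtain \<xi> where "\<xi> \<in> set_pmf m" using set_pmf_not_empty[of m] by auto
  then have "0 < pmf m \<xi>" by (simp add: pmf_positive)
  with reachable[of \<xi> \<eta>] show ?thesis
    by (induction rule: rtrancl_induct) (auto dest: pmf_pos_step)
qed

lemma sum_pmf: "(\<Sum>\<eta>\<in>UNIV. pmf m \<eta>) = 1"
  by (rule sum_pmf_eq_1) auto

section \<open>The Euler scheme and its convergence to the mean\<close>

text \<open>A sum over all states, serving as a crude common bound for the exit rates.\<close>

definition max_rate :: real where
  "max_rate = (\<Sum>\<eta>\<in>UNIV. \<Sum>\<sigma>\<in>G. c \<eta> \<sigma>)"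

lemma rate_le: "(\<Sum>\<sigma>\<in>G. c \<eta> \<sigma>) \<le> max_rate"
  unfolding max_rate_def
  by (rule member_le_sum) (auto intro: sum_nonneg c_nonneg)

lemma euler_pos:
  assumes f: "\<And>\<eta>. 0 < f \<eta>" and h: "0 \<le> h" "h * max_rate < 1"
  shows "0 < euler G c h f \<eta>"
proof -
  let ?r = "\<Sum>\<sigma>\<in>G. c \<eta> \<sigma>"
  have "h * ?r \<le> h * max_rate" using h rate_le by (intro mult_left_mono)
  then have "0 < (1 - h * ?r) * f \<eta>" using h f by simp
  moreover have "0 \<le> h * (\<Sum>\<sigma>\<in>G. c \<eta> \<sigma> * f (\<sigma> \<eta>))"
    using h f by (intro mult_nonneg_nonneg sum_nonneg) (auto simp: c_nonneg less_imp_le)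
  moreover have "euler G c h f \<eta> = (1 - h * ?r) * f \<eta> + h * (\<Sum>\<sigma>\<in>G. c \<eta> \<sigma> * f (\<sigma> \<eta>))"
    by (simp add: euler_def generator_def grad_def algebra_simps sum_subtractf sum_distrib_left)
  ultimately show ?thesis by simp
qed

lemma mean_euler: "(\<Sum>\<eta>\<in>UNIV. euler G c h f \<eta> * pmf m \<eta>) = (\<Sum>\<eta>\<in>UNIV. f \<eta> * pmf m \<eta>)"
proof -
  have "(\<Sum>\<eta>\<in>UNIV. euler G c h f \<eta> * pmf m \<eta>) =
      (\<Sum>\<eta>\<in>UNIV. f \<eta> * pmf m \<eta>) + h * (\<Sum>\<eta>\<in>UNIV. generator G c f \<eta> * pmf m \<eta>)"
    by (simp add: euler_def distrib_right sum.distrib sum_distrib_left mult.assoc)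
  then show ?thesis by (simp add: sum_generator_eq_0)
qed

text \<open>The step preserves the mean, so only the first sum of the entropy changes. Its
  first-order term is an energy with swapped arguments, which symmetry turns into the required
  one.\<close>

lemma entropy_euler_ge:
  assumes adm: "admissible \<phi>" and f: "\<And>\<eta>. 0 < f \<eta>" and h: "0 \<le> h" "h * max_rate < 1"
  shows "phi_entropy m \<phi> f - h * dirichlet G c m (\<lambda>\<eta>. deriv \<phi> (f \<eta>)) f
    \<le> phi_entropy m \<phi> (euler G c h f)"
proof -
  have "(\<Sum>\<eta>\<in>UNIV. (\<phi> (f \<eta>) + deriv \<phi> (f \<eta>) * (euler G c h f \<eta> - f \<eta>)) * pmf m \<eta>)
      \<le> (\<Sum>\<eta>\<in>UNIV. \<phi> (euler G c h f \<eta>) * pmf m \<eta>)"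
    using euler_pos[OF f h] by (intro sum_mono mult_right_mono admissible_tangent[OF adm f]) auto
  moreover have "(\<Sum>\<eta>\<in>UNIV. (\<phi> (f \<eta>) + deriv \<phi> (f \<eta>) * (euler G c h f \<eta> - f \<eta>)) * pmf m \<eta>)
      = (\<Sum>\<eta>\<in>UNIV. \<phi> (f \<eta>) * pmf m \<eta>) - h * dirichlet G c m f (\<lambda>\<eta>. deriv \<phi> (f \<eta>))"
    by (simp add: euler_def dirichlet_def distrib_right sum.distrib sum_distrib_left
        mult.left_commute[of _ h] mult.assoc)
  ultimately show ?thesis
    by (simp add: phi_entropy_def mean_euler dirichlet_commute[of f])
qed

text \<open>Cauchy-Schwarz with each rate split into two square roots; this controls the
  second-order term of an Euler step.\<close>

lemma sum_sq_generator_le: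
  "(\<Sum>\<eta>\<in>UNIV. (generator G c f \<eta>)\<^sup>2 * pmf m \<eta>) \<le> 2 * max_rate * dirichlet G c m f f"
proof -
  have "(generator G c f \<eta>)\<^sup>2 \<le> max_rate * (\<Sum>\<sigma>\<in>G. c \<eta> \<sigma> * (grad \<sigma> f \<eta>)\<^sup>2)" for \<eta>
  proof -
    have "(generator G c f \<eta>)\<^sup>2 = (\<Sum>\<sigma>\<in>G. sqrt (c \<eta> \<sigma>) * (sqrt (c \<eta> \<sigma>) * grad \<sigma> f \<eta>))\<^sup>2"
      by (simp add: generator_def mult.assoc[symmetric] c_nonneg)
    also have "\<dots> \<le> (\<Sum>\<sigma>\<in>G. (sqrt (c \<eta> \<sigma>))\<^sup>2) * (\<Sum>\<sigma>\<in>G. (sqrt (c \<eta> \<sigma>) * grad \<sigma> f \<eta>)\<^sup>2)"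
      by (rule Cauchy_Schwarz_ineq_sum)
    also have "\<dots> = (\<Sum>\<sigma>\<in>G. c \<eta> \<sigma>) * (\<Sum>\<sigma>\<in>G. c \<eta> \<sigma> * (grad \<sigma> f \<eta>)\<^sup>2)"
      by (simp add: power_mult_distrib c_nonneg)
    also have "\<dots> \<le> max_rate * (\<Sum>\<sigma>\<in>G. c \<eta> \<sigma> * (grad \<sigma> f \<eta>)\<^sup>2)"
      by (intro mult_right_mono rate_le sum_nonneg) (auto simp: c_nonneg)
    finally show ?thesis .
  qed
  then have "(\<Sum>\<eta>\<in>UNIV. (generator G c f \<eta>)\<^sup>2 * pmf m \<eta>)
      \<le> (\<Sum>\<eta>\<in>UNIV. (max_rate * (\<Sum>\<sigma>\<in>G. c \<eta> \<sigma> * (grad \<sigma> f \<eta>)\<^sup>2)) * pmf m \<eta>)"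
    by (intro sum_mono mult_right_mono) auto
  also have "\<dots> = max_rate * (2 * dirichlet G c m f f)"
    unfolding dirichlet_eq sum_active
    by (simp add: sum_distrib_left sum_distrib_right grad_def power2_eq_square mult.assoc)
  finally show ?thesis by simp
qed

text \<open>In the expanded square the cross term is \<open>- 2 * h\<close> times the energy, and
  the quadratic term costs at most \<open>2 * h\<^sup>2 * max_rate\<close> times it.\<close>

lemma sum_sq_euler_le:
  assumes "0 \<le> h"
  shows "2 * h * (1 - h * max_rate) * dirichlet G c m f f
    \<le> (\<Sum>\<eta>\<in>UNIV. (f \<eta>)\<^sup>2 * pmf m \<eta>) - (\<Sum>\<eta>\<in>UNIV. (euler G c h f \<eta>)\<^sup>2 * pmf m \<eta>)"
proof -
  have "(\<Sum>\<eta>\<in>UNIV. (euler G c h f \<eta>)\<^sup>2 * pmf m \<eta>) =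
      (\<Sum>\<eta>\<in>UNIV. (f \<eta>)\<^sup>2 * pmf m \<eta> + 2 * h * (f \<eta> * generator G c f \<eta> * pmf m \<eta>)
        + h\<^sup>2 * ((generator G c f \<eta>)\<^sup>2 * pmf m \<eta>))"
    by (intro sum.cong refl) (simp add: euler_def power2_eq_square algebra_simps)
  also have "\<dots> = (\<Sum>\<eta>\<in>UNIV. (f \<eta>)\<^sup>2 * pmf m \<eta>) - 2 * h * dirichlet G c m f f
      + h\<^sup>2 * (\<Sum>\<eta>\<in>UNIV. (generator G c f \<eta>)\<^sup>2 * pmf m \<eta>)"
    by (simp add: sum.distrib sum_distrib_left dirichlet_def)
  also have "\<dots> \<le> (\<Sum>\<eta>\<in>UNIV. (f \<eta>)\<^sup>2 * pmf m \<eta>) - 2 * h * dirichlet G c m f f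
      + h\<^sup>2 * (2 * max_rate * dirichlet G c m f f)"
    by (intro add_left_mono mult_left_mono sum_sq_generator_le) auto
  finally show ?thesis by (simp add: power2_eq_square algebra_simps)
qed

lemma edge_le_dirichlet:
  assumes "(\<eta>, \<sigma>) \<in> active_pairs G c"
  shows "c \<eta> \<sigma> * pmf m \<eta> * (f (\<sigma> \<eta>) - f \<eta>)\<^sup>2 \<le> 2 * dirichlet G c m f f"
proof -
  have "(case (\<eta>, \<sigma>) of (\<eta>, \<sigma>) \<Rightarrow> c \<eta> \<sigma> * ((f (\<sigma> \<eta>) - f \<eta>) * (f (\<sigma> \<eta>) - f \<eta>) * pmf m \<eta>))
      \<le> 2 * dirichlet G c m f f"
    unfolding dirichlet_eq mult_2
    using member_le_sum[OF assms, of "\<lambda>(\<eta>, \<sigma>). c \<eta> \<sigma> * ((f (\<sigma> \<eta>) - f \<eta>) * (f (\<sigma> \<eta>) - f \<eta>) * pmf m \<eta>)"]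
      finite_active by (auto simp: active_pairs_def c_nonneg)
  then show ?thesis by (simp add: power2_eq_square ac_simps)
qed

lemma dirichlet_nonneg: "0 \<le> dirichlet G c m f f"
  unfolding dirichlet_eq
  by (intro mult_nonneg_nonneg sum_nonneg) (auto simp: active_pairs_def c_nonneg)

text \<open>The second moment \<open>V\<close> decreases and is bounded below, so its increments
  tend to \<open>0\<close>. They dominate the energies, hence the differences across active edges
  vanish in the limit.\<close>

lemma euler_tendsto_mean:
  assumes h: "0 < h" "h * max_rate < 1"
  shows "(\<lambda>n. (euler G c h ^^ n) f \<eta>) \<longlonglongrightarrow> (\<Sum>\<eta>\<in>UNIV. f \<eta> * pmf m \<eta>)"
proof -
  define F where "F n = (euler G c h ^^ n) f" for n
  define V where "V n = (\<Sum>\<eta>\<in>UNIV. (F n \<eta>)\<^sup>2 * pmf m \<eta>)" for n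
  define k where "k = 2 * h * (1 - h * max_rate)"
  have k: "0 < k" using h by (simp add: k_def)
  have FSuc: "F (Suc n) = euler G c h (F n)" for n by (simp add: F_def)
  have V: "k * dirichlet G c m (F n) (F n) \<le> V n - V (Suc n)" for n
    using sum_sq_euler_le[of h "F n"] h by (simp add: V_def k_def FSuc)
  have "decseq V"
  proof (rule decseq_SucI)
    fix n
    have "0 \<le> k * dirichlet G c m (F n) (F n)"
      using k dirichlet_nonneg by simp
    with V[of n] show "V (Suc n) \<le> V n" by linarith
  qed
  moreover have "\<forall>n. 0 \<le> V n" by (auto simp: V_def intro!: sum_nonneg)
  ultimately obtain L where L: "V \<longlonglongrightarrow> L" by (rule decseq_convergent)
  have edge: "(\<lambda>n. F n (\<sigma> \<eta>) - F n \<eta>) \<longlonglongrightarrow> 0" if act: "(\<eta>, \<sigma>) \<in> active_pairs G c" for \<eta> \<sigma>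
  proof -
    define e where "e = k * (c \<eta> \<sigma> * pmf m \<eta>)"
    have e: "0 < e" using k pmf_pos act by (simp add: e_def active_pairs_def)
    have le: "(F n (\<sigma> \<eta>) - F n \<eta>)\<^sup>2 \<le> 2 / e * (V n - V (Suc n))" for n
    proof -
      have "e * (F n (\<sigma> \<eta>) - F n \<eta>)\<^sup>2 \<le> 2 * (k * dirichlet G c m (F n) (F n))"
        using mult_left_mono[OF edge_le_dirichlet[OF act, of "F n"], of k] k
        by (simp add: e_def ac_simps)
      also have "\<dots> \<le> 2 * (V n - V (Suc n))" using V[of n] by simp
      finally show ?thesis using e by (simp add: field_simps)
    qed
    have "(\<lambda>n. 2 / e * (V n - V (Suc n))) \<longlonglongrightarrow> 2 / e * (L - L)"
      using L LIMSEQ_Suc[OF L] by (intro tendsto_intros)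
    then have lim: "(\<lambda>n. 2 / e * (V n - V (Suc n))) \<longlonglongrightarrow> 0" by simp
    have "(\<lambda>n. (F n (\<sigma> \<eta>) - F n \<eta>)\<^sup>2) \<longlonglongrightarrow> 0"
      by (rule tendsto_sandwich[OF _ _ tendsto_const lim]) (intro always_eventually allI le; simp)+
    then show ?thesis
      by (simp only: power_tendsto_0_iff)
  qed
  \<comment> \<open>Irreducibility joins any two states by a path of active edges, whose differences
    add up.\<close>
  have diff: "(\<lambda>n. F n \<eta>' - F n \<eta>) \<longlonglongrightarrow> 0" for \<eta> \<eta>'
    using reachable[of \<eta> \<eta>']
  proof (induction rule: rtrancl_induct)
    case (step \<xi> \<zeta>)
    then obtain \<sigma> where "(\<xi>, \<sigma>) \<in> active_pairs G c" "\<zeta> = \<sigma> \<xi>" by auto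
    with edge have "(\<lambda>n. F n \<zeta> - F n \<xi>) \<longlonglongrightarrow> 0" by simp
    from tendsto_add[OF this step.IH] show ?case by simp
  qed simp
  have mean: "(\<Sum>\<xi>\<in>UNIV. F n \<xi> * pmf m \<xi>) = (\<Sum>\<xi>\<in>UNIV. f \<xi> * pmf m \<xi>)" for n
    by (induction n) (simp add: F_def, simp add: FSuc mean_euler)
  \<comment> \<open>The mean is conserved, so \<open>F n \<eta>\<close> deviates from it by an
    average of differences between states.\<close>
  have "F n \<eta> = (\<Sum>\<xi>\<in>UNIV. f \<xi> * pmf m \<xi>) - (\<Sum>\<xi>\<in>UNIV. (F n \<xi> - F n \<eta>) * pmf m \<xi>)" for n
    by (simp add: left_diff_distrib sum_subtractf mean sum_distrib_left[symmetric] sum_pmf)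
  moreover have "(\<lambda>n. (\<Sum>\<xi>\<in>UNIV. f \<xi> * pmf m \<xi>) - (\<Sum>\<xi>\<in>UNIV. (F n \<xi> - F n \<eta>) * pmf m \<xi>))
      \<longlonglongrightarrow> (\<Sum>\<xi>\<in>UNIV. f \<xi> * pmf m \<xi>) - (\<Sum>\<xi>\<in>UNIV. 0 * pmf m \<xi>)"
    by (intro tendsto_intros diff)
  ultimately show ?thesis by (simp add: F_def[symmetric])
qed

text \<open>By the hypothesis, \<open>\<kappa>\<close> times the entropy minus the energy increases along the Euler scheme, while
  its limit is at most \<open>0\<close> because the entropy vanishes at infinity.\<close>

lemma entropy_le_energy_if_euler_decay:
  assumes adm: "admissible \<phi>" and f: "\<And>\<eta>. 0 < f \<eta>"
    and h: "0 < h" "h * max_rate < 1" and \<kappa>: "0 \<le> \<kappa>"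
  defines "E \<equiv> \<lambda>f. dirichlet G c m (\<lambda>\<eta>. deriv \<phi> (f \<eta>)) f"
  assumes decay: "\<And>f. (\<And>\<eta>. 0 < f \<eta>) \<Longrightarrow> E (euler G c h f) \<le> (1 - h * \<kappa>) * E f"
  shows "\<kappa> * phi_entropy m \<phi> f \<le> E f"
proof -
  define F where "F n = (euler G c h ^^ n) f" for n
  have FSuc: "F (Suc n) = euler G c h (F n)" for n by (simp add: F_def)
  have pos: "0 < F n \<eta>" for n \<eta>
    by (induction n arbitrary: \<eta>) (use f euler_pos h in \<open>auto simp: F_def\<close>)
  define \<mu> where "\<mu> = (\<Sum>\<eta>\<in>UNIV. f \<eta> * pmf m \<eta>)"
  have \<mu>: "0 < \<mu>" using f pmf_pos by (auto simp: \<mu>_def intro!: sum_pos)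
  have mean: "(\<Sum>\<xi>\<in>UNIV. F n \<xi> * pmf m \<xi>) = \<mu>" for n
    by (induction n) (simp add: F_def \<mu>_def, simp add: FSuc mean_euler)
  have mono: "\<kappa> * phi_entropy m \<phi> f - E f \<le> \<kappa> * phi_entropy m \<phi> (F n) - E (F n)" for n
  proof (induction n)
    case (Suc n)
    \<comment> \<open>The entropy term loses at most \<open>h * \<kappa> * E (F n)\<close>, and the
      energy drops by at least the same amount.\<close>
    have "\<kappa> * (phi_entropy m \<phi> (F n) - h * E (F n)) \<le> \<kappa> * phi_entropy m \<phi> (F (Suc n))"
      unfolding FSuc E_def using h \<kappa> pos by (intro mult_left_mono entropy_euler_ge[OF adm]) auto
    moreover have "E (F (Suc n)) \<le> (1 - h * \<kappa>) * E (F n)"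
      unfolding FSuc using pos by (rule decay)
    ultimately show ?case using Suc by (simp add: algebra_simps)
  qed (simp add: F_def)
  \<comment> \<open>The limit is the constant \<open>\<mu> > 0\<close>, a point of differentiability
    of \<open>\<phi>\<close>, and a constant has entropy \<open>0\<close>.\<close>
  have "isCont \<phi> \<mu>"
    using adm \<mu> by (auto simp: admissible_def intro: differentiable_imp_continuous_within)
  then have "(\<lambda>n. phi_entropy m \<phi> (F n)) \<longlonglongrightarrow> (\<Sum>\<eta>\<in>UNIV. \<phi> \<mu> * pmf m \<eta>) - \<phi> \<mu>"
    unfolding phi_entropy_def mean using euler_tendsto_mean[OF h, of f]
    by (intro tendsto_intros isCont_tendsto_compose[of \<mu> \<phi>]) (simp_all add: F_def \<mu>_def)
  then have "(\<lambda>n. \<kappa> * phi_entropy m \<phi> (F n)) \<longlonglongrightarrow> \<kappa> * 0"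
    by (intro tendsto_intros) (simp add: sum_distrib_left[symmetric] sum_pmf)
  moreover have "\<kappa> * phi_entropy m \<phi> f - E f \<le> \<kappa> * phi_entropy m \<phi> (F n)" for n
  proof -
    have "0 \<le> E (F n)" unfolding E_def by (intro energy_nonneg adm pos)
    with mono[of n] show ?thesis by linarith
  qed
  ultimately have "\<kappa> * phi_entropy m \<phi> f - E f \<le> \<kappa> * 0"
    by (intro LIMSEQ_le_const) auto
  then show ?thesis by simp
qed

end

section \<open>Couplings\<close>

locale coupled_chain = reversible_chain G c m \<iota>
  for G :: "('a::finite \<Rightarrow> 'a) set" and c m \<iota> +
  fixes cpl :: "'a \<Rightarrow> 'a \<Rightarrow> ('a \<Rightarrow> 'a) option \<Rightarrow> ('a \<Rightarrow> 'a) option \<Rightarrow> real"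
    and \<kappa>' :: real
  assumes coupling: "(\<eta>, \<sigma>) \<in> active_pairs G c \<Longrightarrow> coupling_rates G c \<eta> (\<sigma> \<eta>) (cpl \<eta> (\<sigma> \<eta>))"
    and \<kappa>'_nonneg: "0 \<le> \<kappa>'"
    and contraction: "admissible \<phi> \<Longrightarrow> (\<And>\<eta>. 0 < f \<eta>) \<Longrightarrow>
           1 / 2 * (\<Sum>(\<eta>, \<sigma>)\<in>active_pairs G c. \<Sum>\<gamma>\<in>Gstar G. \<Sum>\<gamma>'\<in>Gstar G.
              c \<eta> \<sigma> * cpl \<eta> (\<sigma> \<eta>) \<gamma> \<gamma>' * grad2 \<gamma> \<gamma>' (f_phi \<phi> f) \<eta> (\<sigma> \<eta>) * pmf m \<eta>)
           \<le> - \<kappa>' * dirichlet G c m (\<lambda>\<eta>. deriv \<phi> (f \<eta>)) f"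
begin

text \<open>The sum includes the pair of two null moves, whose rate the marginal conditions leave
  free.\<close>

definition cpl_rate :: "'a \<Rightarrow> ('a \<Rightarrow> 'a) \<Rightarrow> real" where
  "cpl_rate \<eta> \<sigma> = (\<Sum>(\<gamma>, \<gamma>')\<in>Gstar G \<times> Gstar G. cpl \<eta> (\<sigma> \<eta>) \<gamma> \<gamma>')"

text \<open>Adding \<open>max_rate\<close> lets one smallness condition on \<open>h\<close> secure
  both a positive Euler step and positive Jensen weights on all active pairs.\<close>

definition max_cpl_rate :: real where
  "max_cpl_rate = (\<Sum>(\<eta>, \<sigma>)\<in>active_pairs G c. cpl_rate \<eta> \<sigma>) + max_rate"

lemma cpl_nonneg:
  "(\<eta>, \<sigma>) \<in> active_pairs G c \<Longrightarrow> \<gamma> \<in> Gstar G \<Longrightarrow> \<gamma>' \<in> Gstar G \<Longrightarrow> 0 \<le> cpl \<eta> (\<sigma> \<eta>) \<gamma> \<gamma>'"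
  using coupling by (auto simp: coupling_rates_def)

lemma cpl_rate_nonneg: "(\<eta>, \<sigma>) \<in> active_pairs G c \<Longrightarrow> 0 \<le> cpl_rate \<eta> \<sigma>"
  unfolding cpl_rate_def by (intro sum_nonneg) (auto intro: cpl_nonneg)

lemma max_rate_nonneg: "0 \<le> max_rate"
  unfolding max_rate_def by (intro sum_nonneg c_nonneg)

lemma cpl_rate_le: "(\<eta>, \<sigma>) \<in> active_pairs G c \<Longrightarrow> cpl_rate \<eta> \<sigma> \<le> max_cpl_rate"
  unfolding max_cpl_rate_def
  using member_le_sum[of "(\<eta>, \<sigma>)" "active_pairs G c" "\<lambda>(\<eta>, \<sigma>). cpl_rate \<eta> \<sigma>"]
    cpl_rate_nonneg finite_active max_rate_nonneg by fastforce

lemma max_rate_le: "max_rate \<le> max_cpl_rate"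
  unfolding max_cpl_rate_def using cpl_rate_nonneg by (auto intro!: sum_nonneg)

text \<open>The rate \<open>\<kappa>' + \<mu>\<close> is obtained from the rate \<open>\<kappa>' + \<mu> * (1 - h * max_cpl_rate)\<close> of the Euler scheme
  as \<open>h\<close> tends to \<open>0\<close>.\<close>

lemma entropy_le_energy:
  assumes adm: "admissible \<phi>" and \<mu>: "0 \<le> \<mu>"
    and gain: "\<And>f h \<eta> \<sigma>. (\<And>\<xi>. 0 < f \<xi>) \<Longrightarrow> 0 < h \<Longrightarrow> h * cpl_rate \<eta> \<sigma> < 1 \<Longrightarrow>
        (\<eta>, \<sigma>) \<in> active_pairs G c \<Longrightarrow>
        \<exists>d. (\<forall>\<gamma>\<in>Gstar G. \<forall>\<gamma>'\<in>Gstar G. 0 \<le> d \<gamma> \<gamma>' \<and> d \<gamma> \<gamma>' \<le> cpl \<eta> (\<sigma> \<eta>) \<gamma> \<gamma>' \<and>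
            (d \<gamma> \<gamma>' \<noteq> 0 \<longrightarrow> act \<gamma> \<eta> = act \<gamma>' (\<sigma> \<eta>))) \<and>
          (let w = 1 - h * cpl_rate \<eta> \<sigma>;
               D = h * (\<Sum>(\<gamma>, \<gamma>')\<in>Gstar G \<times> Gstar G. d \<gamma> \<gamma>');
               s = h * (\<Sum>(\<gamma>, \<gamma>')\<in>Gstar G \<times> Gstar G. d \<gamma> \<gamma>' * f (act \<gamma> \<eta>))
           in (w + D) * Phi \<phi> ((w * f \<eta> + s) / (w + D)) ((w * f (\<sigma> \<eta>) + s) / (w + D))
             \<le> w * (1 - h * \<mu>) * Phi \<phi> (f \<eta>) (f (\<sigma> \<eta>)))"
    and f: "\<And>\<eta>. 0 < f \<eta>"
  shows "(\<kappa>' + \<mu>) * phi_entropy m \<phi> f \<le> dirichlet G c m (\<lambda>\<eta>. deriv \<phi> (f \<eta>)) f"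
proof -
  define E where "E f = dirichlet G c m (\<lambda>\<eta>. deriv \<phi> (f \<eta>)) f" for f
  define \<Lambda> where "\<Lambda> = max_cpl_rate"
  let ?S = "active_pairs G c"
  have step: "(\<kappa>' + \<mu> * (1 - h * \<Lambda>)) * phi_entropy m \<phi> f \<le> E f"
    if h: "0 < h" "h * \<Lambda> < 1" for h
    unfolding E_def
  proof (rule entropy_le_energy_if_euler_decay[OF adm f h(1)])
    have "h * max_rate \<le> h * \<Lambda>" using h max_rate_le unfolding \<Lambda>_def by (intro mult_left_mono) auto
    then show "h * max_rate < 1" using h by linarith
    show "0 \<le> \<kappa>' + \<mu> * (1 - h * \<Lambda>)" using \<kappa>'_nonneg \<mu> h by simp
    fix f :: "'a \<Rightarrow> real" assume f: "\<And>\<eta>. 0 < f \<eta>"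
    let ?P = "\<lambda>\<eta> \<sigma>. Phi \<phi> (f \<eta>) (f (\<sigma> \<eta>))"
    let ?B = "\<lambda>\<eta> \<sigma>. \<Sum>\<gamma>\<in>Gstar G. \<Sum>\<gamma>'\<in>Gstar G. cpl \<eta> (\<sigma> \<eta>) \<gamma> \<gamma>' * grad2 \<gamma> \<gamma>' (f_phi \<phi> f) \<eta> (\<sigma> \<eta>)"
    have le: "Phi \<phi> (euler G c h f \<eta>) (euler G c h f (\<sigma> \<eta>))
        \<le> ?P \<eta> \<sigma> + h * ?B \<eta> \<sigma> - h * \<mu> * (1 - h * \<Lambda>) * ?P \<eta> \<sigma>"
      if act: "(\<eta>, \<sigma>) \<in> ?S" for \<eta> \<sigma>
    proof -
      have r: "h * cpl_rate \<eta> \<sigma> \<le> h * \<Lambda>"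
        using h cpl_rate_le[OF act] unfolding \<Lambda>_def by (intro mult_left_mono) auto
      then have r1: "h * cpl_rate \<eta> \<sigma> < 1" using h by linarith
      from gain[of f, OF f h(1) r1 act] obtain d where
        d: "\<And>\<gamma> \<gamma>'. \<gamma> \<in> Gstar G \<Longrightarrow> \<gamma>' \<in> Gstar G \<Longrightarrow> 0 \<le> d \<gamma> \<gamma>' \<and> d \<gamma> \<gamma>' \<le> cpl \<eta> (\<sigma> \<eta>) \<gamma> \<gamma>' \<and>
            (d \<gamma> \<gamma>' \<noteq> 0 \<longrightarrow> act \<gamma> \<eta> = act \<gamma>' (\<sigma> \<eta>))"
        and g: "let w = 1 - h * cpl_rate \<eta> \<sigma>;
               D = h * (\<Sum>(\<gamma>, \<gamma>')\<in>Gstar G \<times> Gstar G. d \<gamma> \<gamma>');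
               s = h * (\<Sum>(\<gamma>, \<gamma>')\<in>Gstar G \<times> Gstar G. d \<gamma> \<gamma>' * f (act \<gamma> \<eta>))
           in (w + D) * Phi \<phi> ((w * f \<eta> + s) / (w + D)) ((w * f (\<sigma> \<eta>) + s) / (w + D))
             \<le> w * (1 - h * \<mu>) * Phi \<phi> (f \<eta>) (f (\<sigma> \<eta>))"
        by blast
      have "Phi \<phi> (euler G c h f \<eta>) (euler G c h f (\<sigma> \<eta>))
          \<le> ?P \<eta> \<sigma> + h * ?B \<eta> \<sigma> - h * \<mu> * (1 - h * cpl_rate \<eta> \<sigma>) * ?P \<eta> \<sigma>"
        unfolding cpl_rate_def using h r1 g
        by (intro Phi_euler_le[OF coupling[OF act] finite_G adm f _ _ d])
          (auto simp: cpl_rate_def Let_def)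
      \<comment> \<open>The rate of the single pair is replaced by the common bound
        \<open>\<Lambda>\<close>, so that the factor can leave the sum over active pairs.\<close>
      moreover have "h * \<mu> * (1 - h * \<Lambda>) * ?P \<eta> \<sigma> \<le> h * \<mu> * (1 - h * cpl_rate \<eta> \<sigma>) * ?P \<eta> \<sigma>"
        using r h \<mu> by (intro mult_right_mono mult_left_mono Phi_nonneg adm f) auto
      ultimately show ?thesis by linarith
    qed
    have "E (euler G c h f) \<le> 1 / 2 * (\<Sum>(\<eta>, \<sigma>)\<in>?S. c \<eta> \<sigma> *
        ((?P \<eta> \<sigma> + h * ?B \<eta> \<sigma> - h * \<mu> * (1 - h * \<Lambda>) * ?P \<eta> \<sigma>) * pmf m \<eta>))"
      unfolding E_def energy_eq
      by (intro mult_left_mono sum_mono) (auto simp: split_beta c_nonneg active_pairs_def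
          intro!: mult_left_mono mult_right_mono le)
    also have "\<dots> = 1 / 2 * (\<Sum>(\<eta>, \<sigma>)\<in>?S. (1 - h * \<mu> * (1 - h * \<Lambda>)) * (c \<eta> \<sigma> * (?P \<eta> \<sigma> * pmf m \<eta>))
        + h * (c \<eta> \<sigma> * ?B \<eta> \<sigma> * pmf m \<eta>))"
      by (intro arg_cong[where f = "(*) (1 / 2)"] sum.cong refl, unfold split_beta, algebra)
    also have "\<dots> = (1 - h * \<mu> * (1 - h * \<Lambda>)) * E f
        + h * (1 / 2 * (\<Sum>(\<eta>, \<sigma>)\<in>?S. c \<eta> \<sigma> * ?B \<eta> \<sigma> * pmf m \<eta>))"
      unfolding E_def energy_eq split_beta sum.distrib sum_distrib_left[symmetric] by algebra
    also have "(\<Sum>(\<eta>, \<sigma>)\<in>?S. c \<eta> \<sigma> * ?B \<eta> \<sigma> * pmf m \<eta>) =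
        (\<Sum>(\<eta>, \<sigma>)\<in>?S. \<Sum>\<gamma>\<in>Gstar G. \<Sum>\<gamma>'\<in>Gstar G.
              c \<eta> \<sigma> * cpl \<eta> (\<sigma> \<eta>) \<gamma> \<gamma>' * grad2 \<gamma> \<gamma>' (f_phi \<phi> f) \<eta> (\<sigma> \<eta>) * pmf m \<eta>)"
      by (simp add: sum_distrib_left sum_distrib_right mult.assoc)
    also have "(1 - h * \<mu> * (1 - h * \<Lambda>)) * E f + h * (1 / 2 * \<dots>)
        \<le> (1 - h * \<mu> * (1 - h * \<Lambda>)) * E f + h * (- \<kappa>' * E f)"
      unfolding E_def using h by (intro add_left_mono mult_left_mono contraction adm f) auto
    also have "\<dots> = (1 - h * (\<kappa>' + \<mu> * (1 - h * \<Lambda>))) * E f"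
      by (simp add: algebra_simps)
    finally show "dirichlet G c m (\<lambda>\<eta>. deriv \<phi> (euler G c h f \<eta>)) (euler G c h f)
        \<le> (1 - h * (\<kappa>' + \<mu> * (1 - h * \<Lambda>))) * dirichlet G c m (\<lambda>\<eta>. deriv \<phi> (f \<eta>)) f"
      by (simp add: E_def)
  qed
  have "((\<lambda>h. (\<kappa>' + \<mu> * (1 - h * \<Lambda>)) * phi_entropy m \<phi> f) \<longlongrightarrow>
      (\<kappa>' + \<mu> * (1 - 0 * \<Lambda>)) * phi_entropy m \<phi> f) (at_right 0)"
    by (intro tendsto_intros)
  moreover have "\<forall>\<^sub>F h in at_right 0. (\<kappa>' + \<mu> * (1 - h * \<Lambda>)) * phi_entropy m \<phi> f \<le> E f"
  proof -
    have "((\<lambda>h. h * \<Lambda>) \<longlongrightarrow> 0 * \<Lambda>) (at_right 0)" by (intro tendsto_intros)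
    then have "\<forall>\<^sub>F h in at_right 0. h * \<Lambda> < 1" by (rule order_tendstoD) simp
    with eventually_at_right_less[of "0::real"] show ?thesis
      by eventually_elim (rule step)
  qed
  ultimately show ?thesis
    by (auto simp: E_def intro: tendsto_upperbound)
qed

section \<open>The three functional inequalities\<close>

lemma convex_sobolev_if_coupled:
  assumes "admissible \<phi>"
  shows "convex_sobolev G c m \<phi> \<kappa>'"
  unfolding convex_sobolev_def
proof (intro allI impI)
  fix f :: "'a \<Rightarrow> real" assume f: "\<forall>\<eta>. 0 < f \<eta>"
  have "(\<kappa>' + 0) * phi_entropy m \<phi> f \<le> dirichlet G c m (\<lambda>\<eta>. deriv \<phi> (f \<eta>)) f"
    \<comment> \<open>With \<open>d = 0\<close> nothing is pooled and the gain condition for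
      \<open>\<mu> = 0\<close> is an equality.\<close>
    by (rule entropy_le_energy[OF assms], simp, rule exI[of _ "\<lambda>_ _. 0"])
      (use f in \<open>auto intro: cpl_nonneg\<close>)
  then show "\<kappa>' * phi_entropy m \<phi> f \<le> dirichlet G c m (\<lambda>\<eta>. deriv \<phi> (f \<eta>)) f"
    by simp
qed

text \<open>Moving only the first copy by \<open>\<sigma>\<close> makes both copies meet at
  \<open>\<sigma> \<eta>\<close>; moving only the second one by \<open>\<iota> \<sigma>\<close>
  makes them meet at \<open>\<eta>\<close>. Taking exactly the rate \<open>k\<close> from each move
  gives the symmetric pooling of \<open>Phi_one_merge\<close>.\<close>

lemma modified_log_sobolev_if_coupled:
  assumes k: "0 \<le> k"
    and le: "\<And>\<eta> \<sigma>. (\<eta>, \<sigma>) \<in> active_pairs G c \<Longrightarrow>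
      k \<le> cpl \<eta> (\<sigma> \<eta>) (Some \<sigma>) None \<and> k \<le> cpl \<eta> (\<sigma> \<eta>) None (Some (\<iota> \<sigma>))"
  shows "modified_log_sobolev G c m (\<kappa>' + 2 * k)"
  unfolding modified_log_sobolev_def
proof (intro allI impI)
  fix f :: "'a \<Rightarrow> real" assume f: "\<forall>\<eta>. 0 < f \<eta>"
  have "(\<kappa>' + 2 * k) * phi_entropy m phi_one f \<le> dirichlet G c m (\<lambda>\<eta>. deriv phi_one (f \<eta>)) f"
  proof (rule entropy_le_energy[OF admissible_phi_one])
    fix f :: "'a \<Rightarrow> real" and h \<eta> \<sigma>
    assume f: "\<And>\<xi>. 0 < f \<xi>" and h: "0 < h" "h * cpl_rate \<eta> \<sigma> < 1"
      and act: "(\<eta>, \<sigma>) \<in> active_pairs G c"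
    let ?I = "Gstar G \<times> Gstar G"
    let ?p = "(Some \<sigma>, None)" and ?q = "(None, Some (\<iota> \<sigma>))"
    define d where "d \<gamma> \<gamma>' = (if (\<gamma>, \<gamma>') = ?p then k else 0) + (if (\<gamma>, \<gamma>') = ?q then k else 0)" for \<gamma> \<gamma>'
    have \<sigma>: "\<sigma> \<in> G" "0 < c \<eta> \<sigma>" using act by (auto simp: active_pairs_def)
    \<comment> \<open>The inverse relation in \<open>Rev\<close> requires positive weight, which
      \<open>pmf_pos\<close> supplies on active pairs.\<close>
    have \<iota>: "\<iota> \<sigma> \<in> G" "\<iota> \<sigma> (\<sigma> \<eta>) = \<eta>" using rev \<sigma> pmf_pos[of \<eta>] by (auto simp: Rev_def)
    have I: "finite ?I" "?p \<in> ?I" "?q \<in> ?I" using \<sigma> \<iota> finite_G by (auto simp: Gstar_def)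
    have d_sum: "(\<Sum>(\<gamma>, \<gamma>')\<in>?I. d \<gamma> \<gamma>' * X \<gamma>) = k * (X (Some \<sigma>) + X None)" for X
    proof -
      have "(\<Sum>(\<gamma>, \<gamma>')\<in>?I. d \<gamma> \<gamma>' * X \<gamma>) =
          (\<Sum>i\<in>?I. (if i = ?p then k * X (Some \<sigma>) else 0) + (if i = ?q then k * X None else 0))"
        by (intro sum.cong refl) (auto simp: d_def split: if_splits)
      then show ?thesis using I by (simp add: sum.distrib distrib_left)
    qed
    have d: "0 \<le> d \<gamma> \<gamma>' \<and> d \<gamma> \<gamma>' \<le> cpl \<eta> (\<sigma> \<eta>) \<gamma> \<gamma>' \<and> (d \<gamma> \<gamma>' \<noteq> 0 \<longrightarrow> act \<gamma> \<eta> = act \<gamma>' (\<sigma> \<eta>))"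
      if "\<gamma> \<in> Gstar G" "\<gamma>' \<in> Gstar G" for \<gamma> \<gamma>'
      using k le[OF act] \<iota> cpl_nonneg[OF act that] by (auto simp: d_def act_def split: if_splits)
    define w where "w = 1 - h * cpl_rate \<eta> \<sigma>"
    have D: "h * (\<Sum>(\<gamma>, \<gamma>')\<in>?I. d \<gamma> \<gamma>') = 2 * (h * k)"
      using d_sum[of "\<lambda>_. 1"] by simp
    have "(\<Sum>(\<gamma>, \<gamma>')\<in>?I. d \<gamma> \<gamma>') \<le> cpl_rate \<eta> \<sigma>"
      unfolding cpl_rate_def using d by (intro sum_mono) auto
    then have wD: "w + 2 * (h * k) \<le> 1"
      unfolding D[symmetric] w_def using h by simp
    have s: "h * (\<Sum>(\<gamma>, \<gamma>')\<in>?I. d \<gamma> \<gamma>' * f (act \<gamma> \<eta>)) = h * k * (f \<eta> + f (\<sigma> \<eta>))"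
      using d_sum[of "\<lambda>\<gamma>. f (act \<gamma> \<eta>)"] by (simp add: act_def algebra_simps)
    have "(w + 2 * (h * k)) * Phi phi_one ((w * f \<eta> + h * k * (f \<eta> + f (\<sigma> \<eta>))) / (w + 2 * (h * k)))
        ((w * f (\<sigma> \<eta>) + h * k * (f \<eta> + f (\<sigma> \<eta>))) / (w + 2 * (h * k)))
        \<le> w * (1 - 2 * (h * k)) * Phi phi_one (f \<eta>) (f (\<sigma> \<eta>))"
      using f h k wD by (intro Phi_one_merge) (auto simp: w_def)
    then show "\<exists>d. (\<forall>\<gamma>\<in>Gstar G. \<forall>\<gamma>'\<in>Gstar G. 0 \<le> d \<gamma> \<gamma>' \<and> d \<gamma> \<gamma>' \<le> cpl \<eta> (\<sigma> \<eta>) \<gamma> \<gamma>' \<and>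
            (d \<gamma> \<gamma>' \<noteq> 0 \<longrightarrow> act \<gamma> \<eta> = act \<gamma>' (\<sigma> \<eta>))) \<and>
          (let w = 1 - h * cpl_rate \<eta> \<sigma>;
               D = h * (\<Sum>(\<gamma>, \<gamma>')\<in>?I. d \<gamma> \<gamma>');
               s = h * (\<Sum>(\<gamma>, \<gamma>')\<in>?I. d \<gamma> \<gamma>' * f (act \<gamma> \<eta>))
           in (w + D) * Phi phi_one ((w * f \<eta> + s) / (w + D)) ((w * f (\<sigma> \<eta>) + s) / (w + D))
             \<le> w * (1 - h * (2 * k)) * Phi phi_one (f \<eta>) (f (\<sigma> \<eta>)))"
      using d by (intro exI[of _ d]) (simp add: D s w_def[symmetric] mult.left_commute[of h 2])
  qed (use f k in auto)
  then show "(\<kappa>' + 2 * k) * phi_entropy m phi_one f \<le> dirichlet G c m (\<lambda>\<eta>. ln (f \<eta>)) f"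
    using f by (simp add: deriv_phi_one)
qed

text \<open>All coupled moves that bring the copies together are pooled, wherever they meet, since
  \<open>Phi_alpha_merge\<close> depends on the meeting points only through
  \<open>s \<ge> 0\<close>.\<close>

lemma beckner_if_coupled:
  assumes \<alpha>: "\<alpha> \<in> {1<..2}" and k: "0 \<le> k"
    and le: "\<And>\<eta> \<sigma>. (\<eta>, \<sigma>) \<in> active_pairs G c \<Longrightarrow>
      k \<le> (\<Sum>(\<gamma>, \<gamma>')\<in>{(\<gamma>, \<gamma>') \<in> Gstar G \<times> Gstar G. act \<gamma> \<eta> = act \<gamma>' (\<sigma> \<eta>)}. cpl \<eta> (\<sigma> \<eta>) \<gamma> \<gamma>')"
  shows "beckner G c m \<alpha> (\<kappa>' + (\<alpha> - 1) * k)"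
  unfolding beckner_def
proof (intro allI impI)
  fix f :: "'a \<Rightarrow> real" assume f: "\<forall>\<eta>. 0 < f \<eta>"
  let ?\<phi> = "phi_alpha \<alpha>"
  have "(\<kappa>' + (\<alpha> - 1) * k) * phi_entropy m ?\<phi> f \<le> dirichlet G c m (\<lambda>\<eta>. deriv ?\<phi> (f \<eta>)) f"
  proof (rule entropy_le_energy[OF admissible_phi_alpha[OF \<alpha>]])
    fix f :: "'a \<Rightarrow> real" and h \<eta> \<sigma>
    assume f: "\<And>\<xi>. 0 < f \<xi>" and h: "0 < h" "h * cpl_rate \<eta> \<sigma> < 1"
      and act: "(\<eta>, \<sigma>) \<in> active_pairs G c"
    let ?I = "Gstar G \<times> Gstar G"
    define d where "d \<gamma> \<gamma>' = (if act \<gamma> \<eta> = act \<gamma>' (\<sigma> \<eta>) then cpl \<eta> (\<sigma> \<eta>) \<gamma> \<gamma>' else 0)" for \<gamma> \<gamma>'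
    have I: "finite ?I" using finite_G by (auto simp: Gstar_def)
    have d: "0 \<le> d \<gamma> \<gamma>' \<and> d \<gamma> \<gamma>' \<le> cpl \<eta> (\<sigma> \<eta>) \<gamma> \<gamma>' \<and> (d \<gamma> \<gamma>' \<noteq> 0 \<longrightarrow> act \<gamma> \<eta> = act \<gamma>' (\<sigma> \<eta>))"
      if "\<gamma> \<in> Gstar G" "\<gamma>' \<in> Gstar G" for \<gamma> \<gamma>'
      using cpl_nonneg[OF act that] by (auto simp: d_def)
    define w where "w = 1 - h * cpl_rate \<eta> \<sigma>"
    define D where "D = h * (\<Sum>(\<gamma>, \<gamma>')\<in>?I. d \<gamma> \<gamma>')"
    define s where "s = h * (\<Sum>(\<gamma>, \<gamma>')\<in>?I. d \<gamma> \<gamma>' * f (act \<gamma> \<eta>))"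
    have "(\<Sum>(\<gamma>, \<gamma>')\<in>{(\<gamma>, \<gamma>') \<in> ?I. act \<gamma> \<eta> = act \<gamma>' (\<sigma> \<eta>)}. cpl \<eta> (\<sigma> \<eta>) \<gamma> \<gamma>') = (\<Sum>(\<gamma>, \<gamma>')\<in>?I. d \<gamma> \<gamma>')"
      using I by (intro sum.mono_neutral_cong_left) (auto simp: d_def split: if_splits)
    then have kD: "h * k \<le> D"
      unfolding D_def using le[OF act] h by (intro mult_left_mono) auto
    have "(\<Sum>(\<gamma>, \<gamma>')\<in>?I. d \<gamma> \<gamma>') \<le> cpl_rate \<eta> \<sigma>"
      unfolding cpl_rate_def using d by (intro sum_mono) auto
    then have wD: "w + D \<le> 1"
      unfolding D_def w_def using h by simp
    have w: "0 < w" using h by (simp add: w_def)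
    have s: "0 \<le> s"
      unfolding s_def using d f h
      by (intro mult_nonneg_nonneg sum_nonneg) (auto simp: split_beta less_imp_le)
    have D: "0 \<le> D" using kD k h by (meson less_imp_le mult_nonneg_nonneg order_trans)
    have "(w + D) * Phi ?\<phi> ((w * f \<eta> + s) / (w + D)) ((w * f (\<sigma> \<eta>) + s) / (w + D))
        \<le> w * (1 - (\<alpha> - 1) * D) * Phi ?\<phi> (f \<eta>) (f (\<sigma> \<eta>))"
      using f w D wD s by (intro Phi_alpha_merge \<alpha>)
    \<comment> \<open>The pooled mass \<open>D\<close> is at least \<open>h * k\<close>; replacing
      it uses \<open>Phi_nonneg\<close>.\<close>
    also have "\<dots> \<le> w * (1 - (\<alpha> - 1) * (h * k)) * Phi ?\<phi> (f \<eta>) (f (\<sigma> \<eta>))"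
      using \<alpha> kD w
      by (intro mult_right_mono mult_left_mono diff_left_mono Phi_nonneg admissible_phi_alpha f) auto
    finally show "\<exists>d. (\<forall>\<gamma>\<in>Gstar G. \<forall>\<gamma>'\<in>Gstar G. 0 \<le> d \<gamma> \<gamma>' \<and> d \<gamma> \<gamma>' \<le> cpl \<eta> (\<sigma> \<eta>) \<gamma> \<gamma>' \<and>
            (d \<gamma> \<gamma>' \<noteq> 0 \<longrightarrow> act \<gamma> \<eta> = act \<gamma>' (\<sigma> \<eta>))) \<and>
          (let w = 1 - h * cpl_rate \<eta> \<sigma>;
               D = h * (\<Sum>(\<gamma>, \<gamma>')\<in>?I. d \<gamma> \<gamma>');
               s = h * (\<Sum>(\<gamma>, \<gamma>')\<in>?I. d \<gamma> \<gamma>' * f (act \<gamma> \<eta>))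
           in (w + D) * Phi ?\<phi> ((w * f \<eta> + s) / (w + D)) ((w * f (\<sigma> \<eta>) + s) / (w + D))
             \<le> w * (1 - h * ((\<alpha> - 1) * k)) * Phi ?\<phi> (f \<eta>) (f (\<sigma> \<eta>)))"
      using d by (intro exI[of _ d])
        (simp add: D_def[symmetric] s_def[symmetric] w_def[symmetric] mult.left_commute[of h "\<alpha> - 1"])
  qed (use f k \<alpha> in auto)
  also have "dirichlet G c m (\<lambda>\<eta>. deriv ?\<phi> (f \<eta>)) f = \<alpha> / (\<alpha> - 1) * dirichlet G c m (\<lambda>\<eta>. f \<eta> powr (\<alpha> - 1)) f"
  proof -
    \<comment> \<open>The symmetric form of the energy sees only differences, so the additive
      constants of \<open>dphi_alpha\<close> drop out.\<close>
    have "deriv ?\<phi> (f x) - deriv ?\<phi> (f y) = \<alpha> / (\<alpha> - 1) * (f x powr (\<alpha> - 1) - f y powr (\<alpha> - 1))" for x y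
      using f \<alpha> by (simp add: deriv_phi_alpha dphi_alpha_def right_diff_distrib)
    then show ?thesis
      unfolding dirichlet_eq by (simp add: sum_distrib_left split_beta ac_simps)
  qed
  finally show "(\<kappa>' + (\<alpha> - 1) * k) * phi_entropy m ?\<phi> f
      \<le> \<alpha> / (\<alpha> - 1) * dirichlet G c m (\<lambda>\<eta>. f \<eta> powr (\<alpha> - 1)) f" .
qed

end

theorem proposition2p1:
  fixes G :: "('a::finite \<Rightarrow> 'a) set"
    and c :: "'a \<Rightarrow> ('a \<Rightarrow> 'a) \<Rightarrow> real"
    and m :: "'a pmf"
    and \<iota> :: "('a \<Rightarrow> 'a) \<Rightarrow> ('a \<Rightarrow> 'a)"
    and cpl :: "'a \<Rightarrow> 'a \<Rightarrow> ('a \<Rightarrow> 'a) option \<Rightarrow> ('a \<Rightarrow> 'a) option \<Rightarrow> real"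
    and \<kappa>' \<kappa>'' \<kappa>''' :: real
  assumes "transition_rates G c"
    and "Irr G c m"
    and "Rev G c m \<iota>"
    and "\<forall>(\<eta>, \<sigma>)\<in>active_pairs G c. coupling_rates G c \<eta> (\<sigma> \<eta>) (cpl \<eta> (\<sigma> \<eta>))"
    and "\<kappa>' \<ge> 0"
    and "\<forall>\<phi> f. admissible \<phi> \<longrightarrow> (\<forall>\<eta>. f \<eta> > 0) \<longrightarrow>
           1 / 2 * (\<Sum>(\<eta>, \<sigma>)\<in>active_pairs G c. \<Sum>\<gamma>\<in>Gstar G. \<Sum>\<gamma>'\<in>Gstar G.
              c \<eta> \<sigma> * cpl \<eta> (\<sigma> \<eta>) \<gamma> \<gamma>' * grad2 \<gamma> \<gamma>' (f_phi \<phi> f) \<eta> (\<sigma> \<eta>) * pmf m \<eta>)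
           \<le> - \<kappa>' * dirichlet G c m (\<lambda>\<eta>. deriv \<phi> (f \<eta>)) f"
    and "\<kappa>'' \<ge> 0" and "\<kappa>''' \<ge> 0"
    and "(INF (\<eta>, \<sigma>)\<in>active_pairs G c.
            ereal (min (cpl \<eta> (\<sigma> \<eta>) (Some \<sigma>) None) (cpl \<eta> (\<sigma> \<eta>) None (Some (\<iota> \<sigma>)))))
          \<ge> ereal \<kappa>''"
    and "(INF (\<eta>, \<sigma>)\<in>active_pairs G c.
            ereal (\<Sum>(\<gamma>, \<gamma>')\<in>{(\<gamma>, \<gamma>') \<in> Gstar G \<times> Gstar G. act \<gamma> \<eta> = act \<gamma>' (\<sigma> \<eta>)}.
              cpl \<eta> (\<sigma> \<eta>) \<gamma> \<gamma>'))
          \<ge> ereal \<kappa>'''"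
  shows "(\<forall>\<phi>. admissible \<phi> \<longrightarrow> convex_sobolev G c m \<phi> \<kappa>') \<and>
         modified_log_sobolev G c m (\<kappa>' + 2 * \<kappa>'') \<and>
         (\<forall>\<alpha>\<in>{1<..2}. beckner G c m \<alpha> (\<kappa>' + (\<alpha> - 1) * \<kappa>'''))"
proof -
  interpret coupled_chain G c m \<iota> cpl \<kappa>'
    using assms(1-6) by unfold_locales auto
  \<comment> \<open>The infima are extended reals and become pointwise bounds; over an empty set of
    active pairs they are \<infinity> and the bounds are vacuous.\<close>
  have one_end: "\<kappa>'' \<le> cpl \<eta> (\<sigma> \<eta>) (Some \<sigma>) None \<and> \<kappa>'' \<le> cpl \<eta> (\<sigma> \<eta>) None (Some (\<iota> \<sigma>))"
    if "(\<eta>, \<sigma>) \<in> active_pairs G c" for \<eta> \<sigma>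
    using order_trans[OF assms(9) INF_lower[OF that]] by simp
  have meet: "\<kappa>''' \<le> (\<Sum>(\<gamma>, \<gamma>')\<in>{(\<gamma>, \<gamma>') \<in> Gstar G \<times> Gstar G. act \<gamma> \<eta> = act \<gamma>' (\<sigma> \<eta>)}. cpl \<eta> (\<sigma> \<eta>) \<gamma> \<gamma>')"
    if "(\<eta>, \<sigma>) \<in> active_pairs G c" for \<eta> \<sigma>
    using order_trans[OF assms(10) INF_lower[OF that]] by simp
  have "convex_sobolev G c m \<phi> \<kappa>'" if "admissible \<phi>" for \<phi>
    using that by (rule convex_sobolev_if_coupled)
  moreover have "modified_log_sobolev G c m (\<kappa>' + 2 * \<kappa>'')"
    using assms(7) one_end by (rule modified_log_sobolev_if_coupled)
  moreover have "beckner G c m \<alpha> (\<kappa>' + (\<alpha> - 1) * \<kappa>''')" if "\<alpha> \<in> {1<..2}" for \<alpha>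
    using that assms(8) meet by (rule beckner_if_coupled)
  ultimately show ?thesis by blast
qed

end
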